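(* Let $d\in\mathbb{N}$, $1\le p\le\infty$, $1\le q\le\infty$ and $0<s<d/2$. Let $U$ be the closed unit ball of $B^s_{pq}(\mathbb{R}^d)$ and let $\mathcal{U}$ be any set of functions obtained by selecting one arbitrary representative from every equivalence class $[f]_\lambda\in U$. Let $\mathbb{P}$ be a probability measure on $\mathbb{R}^d$ possessing a bounded density $\varphi$ with respect to Lebesgue measure such that $\varphi(x)\ge c$ for some constant $c>0$ and all $x$ in some nonempty open subset $V$ of $\mathbb{R}^d$. Then $\mathcal{U}$ is not $\mathbb{P}$-pregaussian.
   Context: $\lambda$ is Lebesgue measure on $\mathbb{R}^d$, $\|h\|_{r,\mu}=(\int|h|^r d\mu)^{1/r}$ (essential supremum if $r=\infty$). Besov spaces: fix a $C^\infty$ function $\varphi_0$ on $\mathbb{R}^d$ with $\varphi_0(x)=1$ for $\|x\|\le1$, $\varphi_0(x)=0$ for $\|x\|\ge3/2$; put $\varphi_1(x)=\varphi_0(x/2)-\varphi_0(x)$, $\varphi_k(x)=\varphi_1(2^{-k+1}x)$. For a tempered distribution $T$, $\|T\|_{s,p,q,\lambda}=\big(\sum_{k\ge0}2^{ksq}\|F^{-1}(\varphi_kFT)\|_{p,\lambda}^q\big)^{1/q}$ (sup-modification for $q=\infty$), $F$ the Fourier transform. $B^s_{pq}(\mathbb{R}^d)$ is the space of real tempered distributions with finite norm; for $s>0$ its elements are equivalence classes (modulo Lebesgue-a.e. equality) of $p$-integrable functions. Pregaussian: for a class $\mathcal{F}$ of functions, a Brownian bridge on $\mathcal{F}$ is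 a centered Gaussian process $\mathbb{G}$ with covariance $E\mathbb{G}(f)\mathbb{G}(g)=\mathbb{P}[(f-\mathbb{P}f)(g-\mathbb{P}g)]$ and induced semimetric $\rho(f,g)=(E[\mathbb{G}(f)-\mathbb{G}(g)]^2)^{1/2}$; $\mathcal{F}\subseteq\mathcal{L}^2(\mathbb{P})$ is $\mathbb{P}$-pregaussian if such $\mathbb{G}$ can be defined with all sample paths bounded and uniformly $\rho$-continuous on $\mathcal{F}$ (in particular a class not contained in $\mathcal{L}^2(\mathbb{P})$ is not $\mathbb{P}$-pregaussian). *)

theory Defs
  imports "HOL-Analysis.Analysis" "HOL-Probability.Probability"
begin

fun Ck :: "nat \<Rightarrow> ('a::euclidean_space \<Rightarrow> real) set" where
  "Ck 0 = {f. continuous_on UNIV f}"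
| "Ck (Suc k) = {f. (\<forall>x. f differentiable (at x)) \<and>
                     (\<forall>v. (\<lambda>x. frechet_derivative f (at x) v) \<in> Ck k)}"

definition C_infinity :: "('a::euclidean_space \<Rightarrow> real) \<Rightarrow> bool" where
  "C_infinity f \<longleftrightarrow> (\<forall>k. f \<in> Ck k)"

definition enn_powr :: "ennreal \<Rightarrow> real \<Rightarrow> ennreal" where
  "enn_powr x a = (if x = \<infinity> then \<infinity> else ennreal (enn2real x powr a))"

definition Lp_norm :: "'a measure \<Rightarrow> ennreal \<Rightarrow> ('a \<Rightarrow> 'b::real_normed_vector) \<Rightarrow> ennreal" where
  "Lp_norm M r h =
     (if r = \<infinity> then e2ennreal (esssup M (\<lambda>x. ereal (norm (h x))))
      else enn_powr (\<integral>\<^sup>+ x. ennreal (norm (h x) powr enn2real r) \<partial>M) (1 / enn2real r))"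

definition dyadic_phi :: "('a::euclidean_space \<Rightarrow> real) \<Rightarrow> nat \<Rightarrow> 'a \<Rightarrow> real" where
  "dyadic_phi phi0 k x =
     (if k = 0 then phi0 x
      else phi0 (((1/2) ^ k) *\<^sub>R x) - phi0 (((1/2) ^ (k - 1)) *\<^sub>R x))"

text \<open>Kernel of the Fourier multiplier: with (F g)(\<xi>) = (2\<pi>)^(-d/2) \<integral> g(x) e^(-i x\<cdot>\<xi>) dx one has
  F^(-1)(m F f) = K * f with K(x) = (2\<pi>)^(-d) \<integral> m(\<xi>) e^(i x\<cdot>\<xi>) d\<xi>.\<close>
definition multiplier_kernel :: "('a::euclidean_space \<Rightarrow> real) \<Rightarrow> 'a \<Rightarrow> complex" where
  "multiplier_kernel m x =
     complex_of_real ((2 * pi) powr (- real DIM('a))) *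
     (LINT \<xi>|lborel. complex_of_real (m \<xi>) * cis (x \<bullet> \<xi>))"

text \<open>F^(-1)(phi_k F f) for a (p-integrable) function f.\<close>
definition dyadic_block :: "('a::euclidean_space \<Rightarrow> real) \<Rightarrow> nat \<Rightarrow> ('a \<Rightarrow> real) \<Rightarrow> 'a \<Rightarrow> complex" where
  "dyadic_block phi0 k f x =
     (LINT y|lebesgue. multiplier_kernel (dyadic_phi phi0 k) (x - y) * complex_of_real (f y))"

definition besov_norm :: "('a::euclidean_space \<Rightarrow> real) \<Rightarrow> real \<Rightarrow> ennreal \<Rightarrow> ennreal \<Rightarrow> ('a \<Rightarrow> real) \<Rightarrow> ennreal" where
  "besov_norm phi0 s p q f =
     (if q = \<infinity> then (SUP k. ennreal (2 powr (real k * s)) * Lp_norm lebesgue p (dyadic_block phi0 k f))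
      else enn_powr (\<Sum>k. ennreal (2 powr (real k * s * enn2real q)) *
                          enn_powr (Lp_norm lebesgue p (dyadic_block phi0 k f)) (enn2real q))
                    (1 / enn2real q))"

text \<open>Closed unit ball of B^s_pq (s > 0), represented by p-integrable real functions.\<close>
definition besov_unit_ball :: "('a::euclidean_space \<Rightarrow> real) \<Rightarrow> real \<Rightarrow> ennreal \<Rightarrow> ennreal \<Rightarrow> ('a \<Rightarrow> real) set" where
  "besov_unit_ball phi0 s p q =
     {f. f \<in> borel_measurable lebesgue \<and> Lp_norm lebesgue p f < \<infinity> \<and> besov_norm phi0 s p q f \<le> 1}"

definition L2_class :: "'a measure \<Rightarrow> ('a \<Rightarrow> real) set" where
  "L2_class M = {f. f \<in> borel_measurable M \<and> integrable M (\<lambda>x. (f x)\<^sup>2)}"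

definition bb_cov :: "'a measure \<Rightarrow> ('a \<Rightarrow> real) \<Rightarrow> ('a \<Rightarrow> real) \<Rightarrow> real" where
  "bb_cov P f g = (\<integral>x. (f x - (\<integral>y. f y \<partial>P)) * (g x - (\<integral>y. g y \<partial>P)) \<partial>P)"

definition centered_normal :: "'w measure \<Rightarrow> ('w \<Rightarrow> real) \<Rightarrow> real \<Rightarrow> bool" where
  "centered_normal \<Omega> X v \<longleftrightarrow> X \<in> borel_measurable \<Omega> \<and>
     (if v = 0 then (AE \<omega> in \<Omega>. X \<omega> = 0) else distributed \<Omega> lborel X (normal_density 0 (sqrt v)))"

definition brownian_bridge :: "'a measure \<Rightarrow> ('a \<Rightarrow> real) set \<Rightarrow> 'w measure \<Rightarrow> (('a \<Rightarrow> real) \<Rightarrow> 'w \<Rightarrow> real) \<Rightarrow> bool" where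
  "brownian_bridge P F \<Omega> G \<longleftrightarrow> prob_space \<Omega> \<and>
     (\<forall>f\<in>F. G f \<in> borel_measurable \<Omega>) \<and>
     (\<forall>fs cs. set fs \<subseteq> F \<and> length cs = length fs \<longrightarrow>
        centered_normal \<Omega> (\<lambda>\<omega>. \<Sum>i<length fs. cs ! i * G (fs ! i) \<omega>)
          (\<Sum>i<length fs. \<Sum>j<length fs. cs ! i * cs ! j * bb_cov P (fs ! i) (fs ! j))) \<and>
     (\<forall>f\<in>F. \<forall>g\<in>F. (\<integral>\<omega>. G f \<omega> * G g \<omega> \<partial>\<Omega>) = bb_cov P f g)"

definition bb_rho :: "'w measure \<Rightarrow> (('a \<Rightarrow> real) \<Rightarrow> 'w \<Rightarrow> real) \<Rightarrow> ('a \<Rightarrow> real) \<Rightarrow> ('a \<Rightarrow> real) \<Rightarrow> real" where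
  "bb_rho \<Omega> G f g = sqrt (\<integral>\<omega>. (G f \<omega> - G g \<omega>)\<^sup>2 \<partial>\<Omega>)"

definition pregaussian :: "'w itself \<Rightarrow> 'a measure \<Rightarrow> ('a \<Rightarrow> real) set \<Rightarrow> bool" where
  "pregaussian (W :: 'w itself) P F \<longleftrightarrow> F \<subseteq> L2_class P \<and>
     (\<exists>(\<Omega> :: 'w measure) G. brownian_bridge P F \<Omega> G \<and>
        (\<forall>\<omega>\<in>space \<Omega>. bounded ((\<lambda>f. G f \<omega>) ` F) \<and>
           (\<forall>e>0. \<exists>\<delta>>0. \<forall>f\<in>F. \<forall>g\<in>F. bb_rho \<Omega> G f g < \<delta> \<longrightarrow> \<bar>G f \<omega> - G g \<omega>\<bar> < e)))"

end

theory Submission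
  imports Defs
begin

text \<open>The Gaussian process is tested on lattice sums
  \<open>f\<^sub>\<epsilon> = 2 powr (- js) * (\<Sum>n. \<epsilon> n * \<chi> (2 ^ j * (x - x0) - n))\<close> with about \<open>2 ^ (jd)\<close> terms located
  in \<open>V\<close> and arbitrary signs. The window \<open>\<chi>\<close> is a tensor product of modulated Fejer kernels whose
  spectrum lies in the annulus \<open>3/2 \<le> norm \<xi> \<le> 2\<close>. On the dilated annulus exactly one dyadic cutoff
  equals 1 and all the others vanish, so \<open>f\<^sub>\<epsilon>\<close> consists of a single Littlewood-Paley block and, up to a
  constant factor, belongs to the unit ball for every choice of signs.

  A Brownian bridge is almost surely linear on finite sets, so choosing the signs pathwise bounds
  \<open>\<Sum>n. \<bar>G (w n)\<bar>\<close> by the supremum of \<open>\<bar>G\<bar>\<close> on the ball, where \<open>w n\<close> is a single scaled translate, of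
  standard deviation of order \<open>2 powr (- js - jd/2)\<close>. These standard deviations sum up to
  \<open>2 powr (j(d/2 - s))\<close>, which is unbounded, and no random variable dominates such Gaussian sums.\<close>

section \<open>Fourier inversion and a band-limited window\<close>

text \<open>A nonzero function with compact spectrum is not compactly supported, so translates of
  the window overlap; this obstacle shapes the estimates. Decay like 1/(1 + t^2) in each coordinate
  bounds the sum of all translates uniformly, and the variance of an atom is bounded below through
  its mass on its own cell of side 2/2^j, where the density is at least \<open>c\<close>. Centering
  subtracts a squared mean of order 2^(-2jd) from a second moment of order 2^(-jd), a negligible
  loss for large j. All p are treated at once: about 2^(jd) atoms, each of L1 norm of order 2^(-jd),
  give a sum whose L1 norm and sup norm are both bounded, and interpolation covers the exponents in
  between. The annulus is the region where neighbouring cutoffs do not overlap: \<open>phi0\<close>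
  vanishes from radius 3/2 on, while phi0(x/2) equals 1 up to radius 2. A Fejer kernel serves as
  window because its transform, a triangle, has compact support and both are explicit.\<close>

lemma integral_std_normal_cis:
  "(LINT t|lborel. complex_of_real (std_normal_density t) * cis (t * s)) = of_real (exp (- s\<^sup>2 / 2))"
proof -
  have "char std_normal_distribution s = of_real (exp (- s\<^sup>2 / 2))"
    by (simp add: char_std_normal_distribution)
  moreover have "char std_normal_distribution s = (LINT t|lborel. std_normal_density t *\<^sub>R cis (t * s))"
    unfolding char_def by (subst integral_density) (auto simp: cis_conv_exp mult.commute)
  ultimately show ?thesis by (simp add: scaleR_conv_of_real)
qed

text \<open>The right side is \<open>sqrt (2 * pi)\<close> times the centered normal density with
  standard deviation \<sigma>, hence an approximate identity as \<sigma> tends to 0; the inversion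
  formula rests on this.\<close>

lemma integral_scaled_normal_cis:
  assumes "\<sigma> > 0"
  shows "(LINT t|lborel. complex_of_real (std_normal_density (\<sigma> * t)) * cis (t * y))
     = of_real (sqrt (2 * pi) / \<sigma> * std_normal_density (y / \<sigma>))"
proof -
  have "(LINT t|lborel. complex_of_real (std_normal_density t) * cis (t * (y / \<sigma>)))
     = \<sigma> *\<^sub>R (LINT t|lborel. complex_of_real (std_normal_density (\<sigma> * t)) * cis (t * y))"
    using assms
    by (subst lborel_integral_real_affine[where c=\<sigma> and t=0]) auto
  then have "\<sigma> *\<^sub>R (LINT t|lborel. complex_of_real (std_normal_density (\<sigma> * t)) * cis (t * y))
     = of_real (exp (- (y / \<sigma>)\<^sup>2 / 2))"
    using integral_std_normal_cis[of "y / \<sigma>"] by simp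
  then have "(LINT t|lborel. complex_of_real (std_normal_density (\<sigma> * t)) * cis (t * y))
     = of_real (exp (- (y / \<sigma>)\<^sup>2 / 2)) / \<sigma>"
    using assms by (simp add: scaleR_conv_of_real field_simps)
  then show ?thesis
    by (simp add: std_normal_density_def)
qed

lemma borel_measurable_cis_comp [measurable (raw)]:
  "f \<in> borel_measurable M \<Longrightarrow> (\<lambda>x. cis (f x)) \<in> borel_measurable M"
  unfolding cis_conv_exp by measurable

text \<open>Gaussian regularization: the weight \<open>std_normal_density (\<sigma> * t)\<close> makes Fubini applicable;
  then let \<open>\<sigma>\<close> tend to 0.\<close>

lemma fourier_inversion_real:
  fixes g h :: "real \<Rightarrow> real"
  assumes cont: "continuous_on UNIV h" and bd: "\<And>x. \<bar>h x\<bar> \<le> B"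
    and hi: "integrable lborel h" and gi: "integrable lborel g"
    and gh: "\<And>t. (LINT x|lborel. complex_of_real (h x) * cis (t * x)) = of_real (2 * pi * g t)"
  shows "(LINT t|lborel. complex_of_real (g t) * cis (- (t * \<xi>))) = of_real (h \<xi>)"
proof -
  let ?n = std_normal_density
  define \<sigma> :: "nat \<Rightarrow> real" where "\<sigma> k = inverse (real (Suc k))" for k
  have \<sigma>pos: "\<sigma> k > 0" for k by (simp add: \<sigma>_def)
  have \<sigma>0: "\<sigma> \<longlonglongrightarrow> 0" unfolding \<sigma>_def by (rule LIMSEQ_inverse_real_of_nat)
  have ncont: "isCont ?n x" for x
    unfolding std_normal_density_def by (auto intro!: continuous_intros)
  have nbd: "\<bar>?n x\<bar> \<le> 1" for x
  proof -
    have "?n x \<le> 1 / sqrt (2 * pi) * 1"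
      unfolding std_normal_density_def by (intro mult_left_mono) auto
    also have "\<dots> \<le> 1" using pi_gt3 by (simp add: real_le_rsqrt)
    finally show ?thesis by simp
  qed
  have hm[measurable]: "h \<in> borel_measurable borel" and gm[measurable]: "g \<in> borel_measurable borel"
    using hi gi by auto
  let ?a = "\<lambda>k. (LINT t|lborel. complex_of_real (g t) * cis (- (t * \<xi>)) * of_real (?n (\<sigma> k * t)))"
  have lim1: "?a \<longlonglongrightarrow> (LINT t|lborel. complex_of_real (g t) * cis (- (t * \<xi>)) * of_real (?n 0))"
  proof (rule integral_dominated_convergence[where w="\<lambda>t. \<bar>g t\<bar>"])
    show "AE t in lborel. (\<lambda>k. complex_of_real (g t) * cis (- (t * \<xi>)) * of_real (?n (\<sigma> k * t)))
        \<longlonglongrightarrow> complex_of_real (g t) * cis (- (t * \<xi>)) * of_real (?n 0)"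
    proof (rule AE_I2, rule tendsto_mult_left, rule tendsto_of_real)
      fix t
      have "(\<lambda>k. \<sigma> k * t) \<longlonglongrightarrow> 0" using tendsto_mult_left_zero[OF \<sigma>0] by simp
      then show "(\<lambda>k. ?n (\<sigma> k * t)) \<longlonglongrightarrow> ?n 0"
        by (rule isCont_tendsto_compose[OF ncont])
    qed
    show "AE t in lborel. norm (complex_of_real (g t) * cis (- (t * \<xi>)) * of_real (?n (\<sigma> k * t))) \<le> \<bar>g t\<bar>" for k
      using nbd by (auto simp: norm_mult intro!: mult_left_le)
  qed (use gi in auto)
  \<comment> \<open>Inserting \<open>gh\<close> turns the regularized integral into a double
    integral. Integrating in t first leaves a Gaussian average of \<open>h\<close> around \<xi>, and
    the substitution x = \<xi> + \<sigma> z moves \<sigma> into the argument of \<open>h\<close>, so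
    that one integrable bound works for all k.\<close>
  have eq: "of_real (2 * pi) * ?a k = of_real (sqrt (2 * pi) * (LINT z|lborel. h (\<xi> + \<sigma> k * z) * ?n z))" for k
  proof -
    have ni: "integrable lborel (\<lambda>t. ?n (\<sigma> k * t))"
      using lborel_integrable_real_affine[of ?n "\<sigma> k" 0] \<sigma>pos[of k] by simp
    have "of_real (2 * pi) * ?a k = (LINT t|lborel. (LINT x|lborel. of_real (h x) * cis (t * (x - \<xi>)) * of_real (?n (\<sigma> k * t))))"
    proof (subst integral_mult_right_zero[symmetric], rule Bochner_Integration.integral_cong[OF refl])
      fix t
      have c: "cis (t * (x - \<xi>)) = cis (t * x) * cis (- (t * \<xi>))" for x
        by (simp add: cis_mult algebra_simps)
      have "of_real (2 * pi) * (of_real (g t) * cis (- (t * \<xi>)) * of_real (?n (\<sigma> k * t)))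
        = (LINT x|lborel. of_real (h x) * cis (t * x)) * (cis (- (t * \<xi>)) * of_real (?n (\<sigma> k * t)))"
        unfolding gh by simp
      also have "\<dots> = (LINT x|lborel. of_real (h x) * cis (t * x) * (cis (- (t * \<xi>)) * of_real (?n (\<sigma> k * t))))"
        by simp
      also have "\<dots> = (LINT x|lborel. of_real (h x) * cis (t * (x - \<xi>)) * of_real (?n (\<sigma> k * t)))"
        by (intro Bochner_Integration.integral_cong refl) (simp add: c mult.assoc)
      finally show "of_real (2 * pi) * (of_real (g t) * cis (- (t * \<xi>)) * of_real (?n (\<sigma> k * t)))
        = (LINT x|lborel. of_real (h x) * cis (t * (x - \<xi>)) * of_real (?n (\<sigma> k * t)))" .
    qed
    also have "\<dots> = (LINT x|lborel. (LINT t|lborel. of_real (h x) * cis (t * (x - \<xi>)) * of_real (?n (\<sigma> k * t))))"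
    proof (rule lborel_pair.Fubini_integral, rule lborel_pair.Fubini_integrable)
      show "integrable lborel (\<lambda>x. LINT y|lborel. norm (case (x, y) of (x, t) \<Rightarrow> complex_of_real (h x) * cis (t * (x - \<xi>)) * of_real (?n (\<sigma> k * t))))"
        using hi by (simp add: norm_mult)
      show "AE x in lborel. integrable lborel (\<lambda>y. case (x, y) of (x, t) \<Rightarrow> complex_of_real (h x) * cis (t * (x - \<xi>)) * of_real (?n (\<sigma> k * t)))"
      proof (rule AE_I2, simp only: prod.case)
        fix x show "integrable lborel (\<lambda>t. complex_of_real (h x) * cis (t * (x - \<xi>)) * of_real (?n (\<sigma> k * t)))"
          by (rule Bochner_Integration.integrable_bound[OF integrable_mult_right[OF ni, of "h x"]])
             (auto simp: norm_mult)
      qed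
    qed (simp add: split_beta')
    also have "\<dots> = (LINT x|lborel. of_real (h x * (sqrt (2 * pi) / \<sigma> k * ?n ((x - \<xi>) / \<sigma> k))))"
    proof (rule Bochner_Integration.integral_cong[OF refl])
      fix x
      have "(LINT t|lborel. of_real (h x) * cis (t * (x - \<xi>)) * complex_of_real (?n (\<sigma> k * t)))
        = of_real (h x) * (LINT t|lborel. complex_of_real (?n (\<sigma> k * t)) * cis (t * (x - \<xi>)))"
        by (subst integral_mult_right_zero[symmetric]) (simp add: ac_simps)
      then show "(LINT t|lborel. of_real (h x) * cis (t * (x - \<xi>)) * complex_of_real (?n (\<sigma> k * t)))
        = of_real (h x * (sqrt (2 * pi) / \<sigma> k * ?n ((x - \<xi>) / \<sigma> k)))"
        by (simp add: integral_scaled_normal_cis[OF \<sigma>pos])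
    qed
    also have "\<dots> = of_real (LINT x|lborel. h x * (sqrt (2 * pi) / \<sigma> k * ?n ((x - \<xi>) / \<sigma> k)))"
      by (rule integral_complex_of_real)
    also have "(LINT x|lborel. h x * (sqrt (2 * pi) / \<sigma> k * ?n ((x - \<xi>) / \<sigma> k)))
       = sqrt (2 * pi) * (LINT z|lborel. h (\<xi> + \<sigma> k * z) * ?n z)"
      using \<sigma>pos[of k] by (subst lborel_integral_real_affine[where c="\<sigma> k" and t=\<xi>])
        (auto simp: field_simps simp flip: integral_mult_right_zero)
    finally show ?thesis .
  qed
  have lim2: "(\<lambda>k. LINT z|lborel. h (\<xi> + \<sigma> k * z) * ?n z) \<longlonglongrightarrow> (LINT z|lborel. h \<xi> * ?n z)"
  proof (rule integral_dominated_convergence[where w="\<lambda>z. B * ?n z"])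
    show "AE z in lborel. (\<lambda>k. h (\<xi> + \<sigma> k * z) * ?n z) \<longlonglongrightarrow> h \<xi> * ?n z"
    proof (rule AE_I2, rule tendsto_mult_right)
      fix z
      have "(\<lambda>k. \<xi> + \<sigma> k * z) \<longlonglongrightarrow> \<xi> + 0"
        using tendsto_mult_left_zero[OF \<sigma>0] by (intro tendsto_intros) simp
      moreover have "isCont h \<xi>" using cont by (simp add: continuous_on_eq_continuous_at)
      ultimately show "(\<lambda>k. h (\<xi> + \<sigma> k * z)) \<longlonglongrightarrow> h \<xi>"
        using isCont_tendsto_compose[of \<xi> h] by simp
    qed
    show "AE z in lborel. norm (h (\<xi> + \<sigma> k * z) * ?n z) \<le> B * ?n z" for k
      using bd by (auto simp: abs_mult intro!: mult_right_mono)
  qed auto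
  have "(\<lambda>k. of_real (2 * pi) * ?a k) \<longlonglongrightarrow> of_real (2 * pi) * (LINT t|lborel. complex_of_real (g t) * cis (- (t * \<xi>)) * of_real (?n 0))"
    by (intro tendsto_mult_left lim1)
  moreover have "(\<lambda>k. of_real (2 * pi) * ?a k) \<longlonglongrightarrow> of_real (sqrt (2 * pi) * (LINT z|lborel. h \<xi> * ?n z))"
    unfolding eq by (intro tendsto_of_real tendsto_mult_left lim2)
  ultimately have "complex_of_real (2 * pi) * (LINT t|lborel. complex_of_real (g t) * cis (- (t * \<xi>)) * of_real (?n 0))
     = of_real (sqrt (2 * pi) * (LINT z|lborel. h \<xi> * ?n z))"
    by (rule LIMSEQ_unique)
  then have "complex_of_real (2 * pi * ?n 0) * (LINT t|lborel. complex_of_real (g t) * cis (- (t * \<xi>)))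
     = of_real (sqrt (2 * pi)) * of_real (h \<xi>)"
    unfolding integral_mult_left_zero of_real_mult integral_mult_right_zero integral_normal_density[OF zero_less_one] of_real_1
    by (simp only: ac_simps mult_1_right mult_1_left)
  moreover have "2 * pi * ?n 0 = sqrt (2 * pi)"
    using real_div_sqrt[of "2 * pi"] by (simp add: std_normal_density_def)
  ultimately show ?thesis by simp
qed

section \<open>The triangle function and its transform, the Fejer kernel\<close>

definition triangle :: "real \<Rightarrow> real" where
  "triangle x = max 0 (1 - \<bar>x\<bar>)"

text \<open>This is (sin(t/2) / (t/2))^2; the value at 0 is its limit, which the quotient alone
  would not give, since division by 0 yields 0.\<close>

definition fejer :: "real \<Rightarrow> real" where
  "fejer t = (if t = 0 then 1 else 2 * (1 - cos t) / t\<^sup>2)"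

lemma continuous_on_triangle [continuous_intros]:
  "continuous_on S f \<Longrightarrow> continuous_on S (\<lambda>x. triangle (f x))"
  unfolding triangle_def by (intro continuous_intros)

lemma borel_measurable_triangle [measurable]: "triangle \<in> borel_measurable borel"
  unfolding triangle_def[abs_def] by measurable

lemma borel_measurable_fejer [measurable]: "fejer \<in> borel_measurable borel"
  unfolding fejer_def[abs_def] by measurable

lemma triangle_bounds: "0 \<le> triangle x" "triangle x \<le> 1"
  by (auto simp: triangle_def)

lemma triangle_eq_0: "1 \<le> \<bar>x\<bar> \<Longrightarrow> triangle x = 0"
  by (auto simp: triangle_def)

lemma integrable_triangle: "integrable lborel triangle"
proof (rule Bochner_Integration.integrable_bound)
  show "integrable lborel (indicat_real {-1..1::real})"
    by (rule integrable_real_indicator) (auto simp: emeasure_lborel_Icc_eq)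
  show "AE x in lborel. norm (triangle x) \<le> norm (indicat_real {-1..1::real} x)"
    by (auto simp: triangle_def indicator_def)
qed simp

text \<open>The antiderivatives are parameters because their form changes at frequency 0:
  polynomials for c = 0, quotients by c and c^2 otherwise.\<close>

lemma has_integral_triangle_exp:
  fixes A B :: "complex \<Rightarrow> complex" and c :: complex
  assumes A: "\<And>z. (A has_field_derivative ((1 + z) * exp (c * z))) (at z)"
    and B: "\<And>z. (B has_field_derivative ((1 - z) * exp (c * z))) (at z)"
  shows "((\<lambda>x. complex_of_real (triangle x) * exp (c * of_real x)) has_integral (A 0 - A (-1)) + (B 1 - B 0)) {-1..1}"
\<comment> \<open>Here \<open>c\<close> is the splitting point of the interval, placed at the kink
  of the triangle; it is not the exponent of the lemma.\<close>
proof (rule has_integral_combine[where c=0])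
  have "((\<lambda>x. (1 + of_real x) * exp (c * of_real x)) has_integral A (of_real 0) - A (of_real (-1))) {-1..0}"
    by (rule fundamental_theorem_of_calculus, simp)
       (rule has_vector_derivative_real_field[OF A])
  then show "((\<lambda>x. complex_of_real (triangle x) * exp (c * of_real x)) has_integral A 0 - A (-1)) {-1..0}"
    by (rule has_integral_eq_rhs[OF has_integral_eq[rotated]]) (auto simp: triangle_def)
  have "((\<lambda>x. (1 - of_real x) * exp (c * of_real x)) has_integral B (of_real 1) - B (of_real 0)) {0..1}"
    by (rule fundamental_theorem_of_calculus, simp)
       (rule has_vector_derivative_real_field[OF B])
  then show "((\<lambda>x. complex_of_real (triangle x) * exp (c * of_real x)) has_integral B 1 - B 0) {0..1}"
    by (rule has_integral_eq_rhs[OF has_integral_eq[rotated]]) (auto simp: triangle_def)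
qed auto

lemma integral_triangle_cis:
  "(LINT x|lborel. complex_of_real (triangle x) * cis (t * x)) = of_real (fejer t)"
proof -
  let ?f = "\<lambda>x. complex_of_real (triangle x) * exp (\<i> * of_real t * of_real x)"
  have "(?f has_integral of_real (fejer t)) {-1..1}"
  proof (cases "t = 0")
    case True
    have "(?f has_integral ((0 + 0^2/2) - (-1 + (-1)^2/2)) + ((1 - 1^2/2) - (0 - 0^2/2))) {-1..1}"
      by (rule has_integral_triangle_exp[where A="\<lambda>z. z + z^2/2" and B="\<lambda>z. z - z^2/2"])
         (auto simp: True intro!: derivative_eq_intros)
    then show ?thesis by (simp add: True fejer_def)
  next
    case False
    define c where "c = \<i> * of_real t"
    have c: "c \<noteq> 0" "c\<^sup>2 = - of_real (t\<^sup>2)"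
      using False by (auto simp: c_def power_mult_distrib)
    \<comment> \<open>Both antiderivatives come from integration by parts. In the boundary terms at
      0 the parts with 1/c cancel, so only multiples of 1/c^2 remain.\<close>
    define A where "A z = (1 + z) * exp (c * z) / c - exp (c * z) / c\<^sup>2" for z
    define B where "B z = (1 - z) * exp (c * z) / c + exp (c * z) / c\<^sup>2" for z
    have "(?f has_integral (A 0 - A (-1)) + (B 1 - B 0)) {-1..1}"
      unfolding c_def[symmetric]
    proof (rule has_integral_triangle_exp)
      show "(A has_field_derivative ((1 + z) * exp (c * z))) (at z)" for z
        unfolding A_def[abs_def] using c(1)
        by (auto intro!: derivative_eq_intros simp: field_simps power2_eq_square)
      show "(B has_field_derivative ((1 - z) * exp (c * z))) (at z)" for z
        unfolding B_def[abs_def] using c(1)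
        by (auto intro!: derivative_eq_intros simp: field_simps power2_eq_square)
    qed
    also have "(A 0 - A (-1)) + (B 1 - B 0) = (exp c + exp (- c) - 2) / c\<^sup>2"
      by (simp add: A_def B_def field_simps add_divide_distrib diff_divide_distrib)
    also have "exp c + exp (- c) = of_real (2 * cos t)"
      unfolding c_def by (simp add: cos_exp_eq cos_of_real[symmetric] del: cos_of_real)
    also have "(of_real (2 * cos t) - 2) / c\<^sup>2 = of_real (fejer t)"
      using False unfolding c(2) by (simp add: fejer_def right_diff_distrib minus_divide_left)
    finally show ?thesis .
  qed
  then have 1: "(?f has_integral of_real (fejer t)) UNIV"
    by (rule has_integral_on_superset) (auto simp: triangle_eq_0)
  have "integrable lborel ?f"
    by (rule Bochner_Integration.integrable_bound[OF integrable_triangle]) (auto simp: norm_mult)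
  then have "(?f has_integral (LINT x|lborel. ?f x)) UNIV"
    by (rule has_integral_integral_lborel)
  from has_integral_unique[OF this 1] show ?thesis
    by (simp add: cis_conv_exp mult.assoc)
qed

text \<open>The constant is 1 + 4. After multiplication by 1 + t^2 there remain
  \<open>fejer t\<close> itself, at most 1 because 1 - cos t = 2 sin(t/2)^2 is at most t^2/2, and
  the numerator 2 (1 - cos t), at most 4.\<close>

lemma fejer_bound: "\<bar>fejer t\<bar> \<le> 5 / (1 + t\<^sup>2)"
proof (cases "t = 0")
  case False
  have 1: "2 * (1 - cos t) \<le> t\<^sup>2"
    using cos_squared_eq[of "t/2"] abs_sin_le_one cos_double_sin[of "t/2"] abs_sin_x_le_abs_x[of "t/2"]
      power_mono[of "\<bar>sin (t/2)\<bar>" "\<bar>t/2\<bar>" 2] by (auto simp: power_divide)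
  have 2: "0 \<le> 1 - cos t" "1 - cos t \<le> 2"
    using cos_le_one[of t] cos_ge_minus_one[of t] by linarith+
  have "\<bar>fejer t\<bar> * (1 + t\<^sup>2) = 2 * (1 - cos t) / t\<^sup>2 + 2 * (1 - cos t)"
    using False 2 by (simp add: fejer_def field_simps)
  also have "\<dots> \<le> 1 + 2 * 2"
    proof (rule add_mono)
    show "2 * (1 - cos t) / t\<^sup>2 \<le> 1" using 1 False by (simp add: divide_le_eq)
    show "2 * (1 - cos t) \<le> 2 * 2" by (rule mult_left_mono[OF 2(2)]) simp
  qed
  finally have "\<bar>fejer t\<bar> * (1 + t\<^sup>2) \<le> 5" by simp
  moreover have "0 < 1 + t\<^sup>2" by (simp add: add_pos_nonneg)
  ultimately show ?thesis by (simp add: le_divide_eq)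
qed (simp add: fejer_def)

lemma integrable_inverse_1_plus_sq: "integrable lborel (\<lambda>t::real. C / (1 + t\<^sup>2))"
proof -
  have "integrable lborel (\<lambda>t::real. inverse (1 + t\<^sup>2))"
    using integrable_inverse_1_plus_square by (simp add: set_integrable_def)
  from integrable_mult_right[OF this, of C] show ?thesis by (simp add: field_simps)
qed

lemma integrable_inverse_square_decay:
  fixes g :: "real \<Rightarrow> real"
  assumes "g \<in> borel_measurable borel" "\<And>t. \<bar>g t\<bar> \<le> C / (1 + t\<^sup>2)"
  shows "integrable lborel g"
proof (rule Bochner_Integration.integrable_bound[OF integrable_inverse_1_plus_sq[of C]])
  show "AE t in lborel. norm (g t) \<le> norm (C / (1 + t\<^sup>2))"
    unfolding real_norm_def by (rule AE_I2, rule order_trans[OF assms(2) abs_ge_self])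
qed (use assms in auto)

text \<open>Averaging two triangles centered at \<omega> and -\<omega> makes the spectrum even, so
  that \<open>g\<close> is real: a Fejer kernel times cos(\<omega> t). For \<delta> < \<omega> the
  spectrum also stays away from 0. The nonvanishing on an interval later makes the variances
  positive.\<close>

lemma band_limited_function_exists:
  fixes \<delta> \<omega> :: real
  assumes \<delta>: "0 < \<delta>" and \<omega>: "0 < \<omega>"
  obtains g h :: "real \<Rightarrow> real" and C r :: real where
    "0 < C" "g \<in> borel_measurable borel" "\<And>t. \<bar>g t\<bar> \<le> C / (1 + t\<^sup>2)"
    "continuous_on UNIV h" "\<And>\<tau>. \<bar>h \<tau>\<bar> \<le> 1" "integrable lborel h"
    "\<And>\<tau>. \<delta> < \<bar>\<bar>\<tau>\<bar> - \<omega>\<bar> \<Longrightarrow> h \<tau> = 0"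
    "\<And>\<tau>. (LINT t|lborel. complex_of_real (g t) * cis (- (t * \<tau>))) = of_real (h \<tau>)"
    "\<And>t. (LINT \<tau>|lborel. complex_of_real (h \<tau>) * cis (t * \<tau>)) = of_real (2 * pi * g t)"
    "0 < r" "\<And>t. 0 < t \<Longrightarrow> t < r \<Longrightarrow> g t \<noteq> 0"
proof
  define h where "h \<tau> = (triangle ((\<tau> - \<omega>) / \<delta>) + triangle ((\<tau> + \<omega>) / \<delta>)) / 2" for \<tau>
  define g where "g t = \<delta> / (2 * pi) * cos (\<omega> * t) * fejer (\<delta> * t)" for t
  \<comment> \<open>The inequality 1 + t^2 \<le> (1 + 1/\<delta>^2) (1 + (\<delta> t)^2) carries the
    decay of \<open>fejer\<close> from the scale of \<delta> t to that of t; the 5 is from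
    \<open>fejer_bound\<close>, and \<delta> bounds the prefactor \<delta> / (2 pi).\<close>
  define C where "C = \<delta> * 5 * (1 + 1 / \<delta>\<^sup>2)"
  \<comment> \<open>For 0 < t < r both \<omega> t and \<delta> t lie below 1 < pi/2, so the cosine
    factor and the numerator of \<open>fejer\<close> are both positive.\<close>
  define r where "r = min (1 / \<omega>) (1 / \<delta>)"
  show "0 < C" using \<delta> by (simp add: C_def add_pos_nonneg)
  show gm: "g \<in> borel_measurable borel" unfolding g_def[abs_def] by measurable
  show gC: "\<bar>g t\<bar> \<le> C / (1 + t\<^sup>2)" for t
  proof -
    have pos: "0 < 1 + t\<^sup>2" "0 < 1 + (\<delta> * t)\<^sup>2" by (auto simp: add_pos_nonneg)
    have "\<delta> / (2 * pi) \<le> \<delta> / 1"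
      using \<delta> pi_gt3 by (intro divide_left_mono) auto
    then have "\<bar>g t\<bar> \<le> \<delta> * 1 * (5 / (1 + (\<delta> * t)\<^sup>2))"
      unfolding g_def abs_mult using \<delta> fejer_bound[of "\<delta> * t"] by (intro mult_mono) auto
    also have "\<dots> \<le> C / (1 + t\<^sup>2)"
    proof -
      have "1 + t\<^sup>2 \<le> (1 + 1 / \<delta>\<^sup>2) * (1 + (\<delta> * t)\<^sup>2)"
        using \<delta> by (simp add: field_simps)
      then have "\<delta> * 5 * (1 + t\<^sup>2) \<le> \<delta> * 5 * ((1 + 1 / \<delta>\<^sup>2) * (1 + (\<delta> * t)\<^sup>2))"
        using \<delta> by (intro mult_left_mono) auto
      then show ?thesis using pos unfolding C_def by (simp only: divide_le_eq le_divide_eq mult_1_right times_divide_eq_right times_divide_eq_left if_True simp_thms mult.assoc)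
    qed
    finally show ?thesis .
  qed
  show hc: "continuous_on UNIV h"
    unfolding h_def[abs_def] using \<delta> by (intro continuous_intros) auto
  show hb: "\<bar>h \<tau>\<bar> \<le> 1" for \<tau>
    using triangle_bounds[of "(\<tau> - \<omega>) / \<delta>"] triangle_bounds[of "(\<tau> + \<omega>) / \<delta>"] by (simp add: h_def)
  have i: "integrable lborel (\<lambda>\<tau>. triangle ((\<tau> - a) / \<delta>))" for a
    using lborel_integrable_real_affine[OF integrable_triangle, of "1/\<delta>" "- a/\<delta>"] \<delta>
    by (simp add: diff_divide_distrib)
  show hi: "integrable lborel h"
    unfolding h_def[abs_def] using i[of \<omega>] i[of "-\<omega>"] by auto
  show "h \<tau> = 0" if "\<delta> < \<bar>\<bar>\<tau>\<bar> - \<omega>\<bar>" for \<tau>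
  proof -
    have "\<delta> \<le> \<bar>\<tau> - \<omega>\<bar>" "\<delta> \<le> \<bar>\<tau> + \<omega>\<bar>" using that \<omega> by auto
    then show ?thesis using \<delta> by (simp add: h_def triangle_eq_0)
  qed
  have shift: "(LINT \<tau>|lborel. complex_of_real (triangle ((\<tau> - a) / \<delta>)) * cis (t * \<tau>)) = of_real (\<delta> * fejer (\<delta> * t)) * cis (t * a)" for a t
  proof -
    have "(LINT \<tau>|lborel. complex_of_real (triangle ((\<tau> - a) / \<delta>)) * cis (t * \<tau>))
      = \<delta> *\<^sub>R (LINT u|lborel. (complex_of_real (triangle u) * cis ((\<delta> * t) * u)) * cis (t * a))"
      using \<delta> by (subst lborel_integral_real_affine[where c=\<delta> and t=a]) (auto simp: cis_mult algebra_simps)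
    then show ?thesis by (simp add: integral_triangle_cis scaleR_conv_of_real)
  qed
  show gh: "(LINT \<tau>|lborel. complex_of_real (h \<tau>) * cis (t * \<tau>)) = of_real (2 * pi * g t)" for t
  proof -
    have ic: "integrable lborel (\<lambda>\<tau>. complex_of_real (triangle ((\<tau> - a) / \<delta>)) * cis (t * \<tau>))" for a
      by (rule Bochner_Integration.integrable_bound[OF i[of a]]) (auto simp: norm_mult)
    have "(LINT \<tau>|lborel. complex_of_real (h \<tau>) * cis (t * \<tau>))
      = (LINT \<tau>|lborel. (complex_of_real (triangle ((\<tau> - \<omega>) / \<delta>)) * cis (t * \<tau>)
          + complex_of_real (triangle ((\<tau> - (-\<omega>)) / \<delta>)) * cis (t * \<tau>)) / 2)"
      by (intro Bochner_Integration.integral_cong refl) (simp add: h_def field_simps)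
    also have "\<dots> = (of_real (\<delta> * fejer (\<delta> * t)) * cis (t * \<omega>) + of_real (\<delta> * fejer (\<delta> * t)) * cis (t * (-\<omega>))) / 2"
      by (simp only: integral_divide_zero Bochner_Integration.integral_add[OF ic ic] shift)
    also have "\<dots> = of_real (2 * pi * g t)"
      by (rule complex_eqI) (simp_all add: g_def field_simps)
    finally show ?thesis .
  qed
  show "(LINT t|lborel. complex_of_real (g t) * cis (- (t * \<tau>))) = of_real (h \<tau>)" for \<tau>
    by (rule fourier_inversion_real[OF hc hb hi integrable_inverse_square_decay[OF gm gC] gh])
  show "0 < r" using \<delta> \<omega> by (simp add: r_def)
  show "g t \<noteq> 0" if t: "0 < t" "t < r" for t
  proof -
    have "\<omega> * t < 1" "\<delta> * t < 1" using t \<delta> \<omega> by (auto simp: r_def field_simps)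
    moreover have "1 < pi / 2" using pi_gt3 by simp
    ultimately have w: "\<omega> * t < pi / 2" and d: "\<delta> * t < pi / 2" by linarith+
    have "0 < cos (\<omega> * t)" using w t \<omega> by (intro cos_gt_zero) auto
    moreover have "cos (\<delta> * t) < cos 0" using d t \<delta> pi_gt3 by (intro cos_monotone_0_pi) auto
    ultimately show ?thesis using t \<delta> by (simp add: g_def fejer_def)
  qed
qed

section \<open>Fourier pairs in several variables\<close>

text \<open>By \<open>lborel_eq\<close> the measure is the image of the product of one-dimensional
  Lebesgue measures under the coordinate map, which reduces the claim to the product rule for finite
  product measures.\<close>

lemma lborel_integral_prod:
  fixes f :: "'a::euclidean_space \<Rightarrow> real \<Rightarrow> 'b::{real_normed_field,banach,second_countable_topology}"
  assumes f: "\<And>b. b \<in> Basis \<Longrightarrow> integrable lborel (f b)"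
  shows "integrable lborel (\<lambda>x::'a. \<Prod>b\<in>Basis. f b (x \<bullet> b))"
    and "(LINT x|lborel. (\<Prod>b\<in>Basis. f b ((x::'a) \<bullet> b))) = (\<Prod>b\<in>Basis. LINT t|lborel. f b t)"
proof -
  interpret product_sigma_finite "\<lambda>_::'a. lborel :: real measure" ..
  let ?T = "\<lambda>f::'a \<Rightarrow> real. \<Sum>b\<in>Basis. f b *\<^sub>R b"
  have T: "?T \<in> measurable (\<Pi>\<^sub>M b\<in>Basis. lborel) borel" by simp
  have [measurable]: "f b \<in> borel_measurable borel" if "b \<in> Basis" for b
    using f[OF that] by (simp add: borel_measurable_integrable[where M=lborel, simplified])
  have m: "(\<lambda>x::'a. \<Prod>b\<in>Basis. f b (x \<bullet> b)) \<in> borel_measurable borel"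
    by (intro borel_measurable_prod) measurable
  have *: "(\<Prod>b\<in>Basis. f b (?T x \<bullet> b)) = (\<Prod>b\<in>Basis. f b (x b))" for x
    by (intro prod.cong refl) simp
  show "integrable lborel (\<lambda>x::'a. \<Prod>b\<in>Basis. f b (x \<bullet> b))"
    by (subst lborel_eq, subst integrable_distr_eq[OF T m])
       (simp only: *, rule product_integrable_prod, auto intro: f)
  show "(LINT x|lborel. (\<Prod>b\<in>Basis. f b ((x::'a) \<bullet> b))) = (\<Prod>b\<in>Basis. LINT t|lborel. f b t)"
    by (subst lborel_eq, subst integral_distr[OF T m])
       (simp only: *, rule product_integral_prod, auto intro: f)
qed

text \<open>Each term is compared with an increment of \<open>arctan\<close>, so that the sum telescopes.\<close>

lemma sum_shifted_inverse_squares_le: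
  "(\<Sum>k<m. 1 / (1 + (y - real k)\<^sup>2)) \<le> 3 * pi"
proof -
  \<comment> \<open>The factor 3 pays for moving from u = k - y to the intermediate point z of the
    mean value theorem: \<bar>z\<bar> \<le> \<bar>u\<bar> + 1 gives 1 + z^2 \<le> 3 + 2 u^2 \<le> 3
    (1 + u^2).\<close>
  have step: "1 / (1 + (y - real k)\<^sup>2) \<le> 3 * (arctan (real (Suc k) - y) - arctan (real k - y))" for k
  proof -
    define u where "u = real k - y"
    have "\<exists>z. u < z \<and> z < u + 1 \<and> arctan (u + 1) - arctan u = (u + 1 - u) * inverse (1 + z\<^sup>2)"
      by (rule MVT2) (auto intro: DERIV_arctan)
    then obtain z where z: "u < z" "z < u + 1" "arctan (u + 1) - arctan u = inverse (1 + z\<^sup>2)" by auto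
    have "\<bar>z\<bar> \<le> \<bar>u\<bar> + 1" using z by linarith
    then have "z\<^sup>2 \<le> (\<bar>u\<bar> + 1)\<^sup>2" by (rule abs_le_square_iff[THEN iffD1, of z "\<bar>u\<bar> + 1", simplified])
    also have "\<dots> \<le> 2 * u\<^sup>2 + 2"
      using zero_le_power2[of "\<bar>u\<bar> - 1"] by (simp add: power2_eq_square algebra_simps)
    finally have "1 + z\<^sup>2 \<le> 1 + (2 * u\<^sup>2 + 2)" by simp
    also have "\<dots> \<le> 3 * (1 + u\<^sup>2)" by simp
    finally have "1 + z\<^sup>2 \<le> 3 * (1 + u\<^sup>2)" .
    moreover have "0 < 1 + z\<^sup>2" "0 < 1 + u\<^sup>2" by (auto simp: add_pos_nonneg)
    ultimately have "1 / (1 + u\<^sup>2) \<le> 3 * inverse (1 + z\<^sup>2)"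
      by (simp add: field_simps)
    then show ?thesis using z(3) by (simp add: u_def power2_commute algebra_simps)
  qed
  have "(\<Sum>k<m. 1 / (1 + (y - real k)\<^sup>2)) \<le> (\<Sum>k<m. 3 * (arctan (real (Suc k) - y) - arctan (real k - y)))"
    by (intro sum_mono step)
  also have "\<dots> = 3 * (arctan (real m - y) - arctan (real 0 - y))"
    unfolding sum_distrib_left[symmetric] by (subst sum_lessThan_telescope) simp
  also have "\<dots> \<le> 3 * pi"
    using arctan_ubound[of "real m - y"] arctan_lbound[of "real 0 - y"] by simp
  finally show ?thesis .
qed

text \<open>Inversion is built into the notion: it is established once, for the one-dimensional
  window, and then inherited by affine substitutions, tensor products and linear combinations. The
  constants match \<open>multiplier_kernel\<close>, with the factor (2 pi)^d on the inverse side;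
  \<open>H\<close> is complex since translation produces phases.\<close>

definition fourier_pair :: "('a::euclidean_space \<Rightarrow> real) \<Rightarrow> ('a \<Rightarrow> complex) \<Rightarrow> bool" where
  "fourier_pair f H \<longleftrightarrow> integrable lborel f \<and> integrable lborel H \<and>
     (\<forall>\<xi>. (LINT y|lborel. complex_of_real (f y) * cis (- (y \<bullet> \<xi>))) = H \<xi>) \<and>
     (\<forall>x. (LINT \<xi>|lborel. H \<xi> * cis (x \<bullet> \<xi>)) = of_real ((2 * pi) ^ DIM('a) * f x))"

lemma fourier_pairD:
  assumes "fourier_pair (f :: 'a::euclidean_space \<Rightarrow> real) H"
  shows "integrable lborel f" "integrable lborel H"
    "(LINT y|lborel. complex_of_real (f y) * cis (- (y \<bullet> \<xi>))) = H \<xi>"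
    "(LINT \<xi>|lborel. H \<xi> * cis (x \<bullet> \<xi>)) = of_real ((2 * pi) ^ DIM('a) * f x)"
  using assms by (auto simp: fourier_pair_def)

lemma integrable_mult_cis:
  assumes "integrable M (f :: _ \<Rightarrow> complex)" "u \<in> borel_measurable M"
  shows "integrable M (\<lambda>x. f x * cis (u x))"
  by (rule Bochner_Integration.integrable_bound[OF assms(1)]) (use assms in \<open>auto simp: norm_mult\<close>)

lemma fourier_pair_sum:
  fixes f :: "'i \<Rightarrow> 'a::euclidean_space \<Rightarrow> real"
  assumes I: "finite I" and p: "\<And>i. i \<in> I \<Longrightarrow> fourier_pair (f i) (H i)"
  shows "fourier_pair (\<lambda>x. \<Sum>i\<in>I. a i * f i x) (\<lambda>\<xi>. \<Sum>i\<in>I. of_real (a i) * H i \<xi>)"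
  unfolding fourier_pair_def
proof (intro conjI allI)
  note [simp] = fourier_pairD[OF p]
  show "integrable lborel (\<lambda>x. \<Sum>i\<in>I. a i * f i x)"
    "integrable lborel (\<lambda>\<xi>. \<Sum>i\<in>I. of_real (a i) * H i \<xi>)" by auto
  fix \<xi>
  have i: "integrable lborel (\<lambda>y. complex_of_real (f i y) * cis (- (y \<bullet> \<xi>)))" if "i \<in> I" for i
    using that by (intro integrable_mult_cis) auto
  have "(LINT y|lborel. complex_of_real (\<Sum>i\<in>I. a i * f i y) * cis (- (y \<bullet> \<xi>)))
    = (LINT y|lborel. (\<Sum>i\<in>I. of_real (a i) * (complex_of_real (f i y) * cis (- (y \<bullet> \<xi>)))))"
    by (simp add: sum_distrib_right mult.assoc)
  also have "\<dots> = (\<Sum>i\<in>I. of_real (a i) * H i \<xi>)"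
    using i by (subst Bochner_Integration.integral_sum) auto
  finally show "(LINT y|lborel. complex_of_real (\<Sum>i\<in>I. a i * f i y) * cis (- (y \<bullet> \<xi>))) = (\<Sum>i\<in>I. of_real (a i) * H i \<xi>)" .
next
  note [simp] = fourier_pairD[OF p]
  fix x
  have i: "integrable lborel (\<lambda>\<xi>. H i \<xi> * cis (x \<bullet> \<xi>))" if "i \<in> I" for i
    using that by (intro integrable_mult_cis) auto
  have "(LINT \<xi>|lborel. (\<Sum>i\<in>I. of_real (a i) * H i \<xi>) * cis (x \<bullet> \<xi>))
    = (LINT \<xi>|lborel. (\<Sum>i\<in>I. of_real (a i) * (H i \<xi> * cis (x \<bullet> \<xi>))))"
    by (simp add: sum_distrib_right mult.assoc)
  also have "\<dots> = (\<Sum>i\<in>I. of_real (a i) * of_real ((2 * pi) ^ DIM('a) * f i x))"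
    using i by (subst Bochner_Integration.integral_sum) auto
  also have "\<dots> = of_real ((2 * pi) ^ DIM('a) * (\<Sum>i\<in>I. a i * f i x))"
    by (simp add: sum_distrib_left ac_simps)
  finally show "(LINT \<xi>|lborel. (\<Sum>i\<in>I. of_real (a i) * H i \<xi>) * cis (x \<bullet> \<xi>))
    = of_real ((2 * pi) ^ DIM('a) * (\<Sum>i\<in>I. a i * f i x))" .
qed

lemma fourier_pair_real_affine:
  fixes g :: "real \<Rightarrow> real"
  assumes p: "fourier_pair g h" and c: "c > 0"
  shows "fourier_pair (\<lambda>t. g (c * t + a)) (\<lambda>\<tau>. of_real (1 / c) * (h (\<tau> / c) * cis (\<tau> / c * a)))"
  unfolding fourier_pair_def
proof (intro conjI allI)
  note [simp] = fourier_pairD(1,2)[OF p]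
  show "integrable lborel (\<lambda>t. g (c * t + a))"
    using lborel_integrable_real_affine[of g c a] c by (simp add: add.commute)
  have "integrable lborel (\<lambda>\<tau>. h (\<tau> / c))"
    using lborel_integrable_real_affine[of h "1/c" 0] c by simp
  then show "integrable lborel (\<lambda>\<tau>. of_real (1 / c) * (h (\<tau> / c) * cis (\<tau> / c * a)))"
    by (intro integrable_mult_right integrable_mult_cis) auto
  fix \<tau> t :: real
  have eq: "complex_of_real (g (a + c * y)) * cis (- ((a + c * y) \<bullet> (\<tau> / c))) * cis (\<tau> / c * a)
     = complex_of_real (g (c * y + a)) * cis (- (y \<bullet> \<tau>))" for y
    using c by (simp add: mult.assoc cis_mult field_simps)
  have "h (\<tau> / c) * cis (\<tau> / c * a) = (LINT u|lborel. complex_of_real (g u) * cis (- (u \<bullet> (\<tau> / c))) * cis (\<tau> / c * a))"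
    by (simp only: integral_mult_left_zero fourier_pairD(3)[OF p])
  also have "\<dots> = c *\<^sub>R (LINT y|lborel. complex_of_real (g (c * y + a)) * cis (- (y \<bullet> \<tau>)))"
    using c by (subst lborel_integral_real_affine[where c=c and t=a]) (simp_all only: eq, simp_all)
  finally show "(LINT y|lborel. complex_of_real (g (c * y + a)) * cis (- (y \<bullet> \<tau>)))
     = of_real (1 / c) * (h (\<tau> / c) * cis (\<tau> / c * a))"
    using c by (simp add: scaleR_conv_of_real)
  have eq2: "of_real (1 / c) * (h ((0 + c * \<xi>) / c) * cis ((0 + c * \<xi>) / c * a)) * cis (t \<bullet> (0 + c * \<xi>))
     = of_real (1 / c) * (h \<xi> * cis ((c * t + a) \<bullet> \<xi>))" for \<xi>
    using c by (simp add: mult.assoc cis_mult algebra_simps)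
  have "(LINT \<xi>|lborel. of_real (1 / c) * (h (\<xi> / c) * cis (\<xi> / c * a)) * cis (t \<bullet> \<xi>))
     = (LINT \<xi>|lborel. h \<xi> * cis ((c * t + a) \<bullet> \<xi>))"
    using c by (subst lborel_integral_real_affine[where c=c and t=0])
      (simp_all only: eq2, simp_all add: scaleR_conv_of_real)
  then show "(LINT \<xi>|lborel. of_real (1 / c) * (h (\<xi> / c) * cis (\<xi> / c * a)) * cis (t \<bullet> \<xi>))
     = of_real ((2 * pi) ^ DIM(real) * g (c * t + a))"
    by (simp only: fourier_pairD(4)[OF p])
qed

lemma cis_inner_eq_prod: "cis (x \<bullet> y) = (\<Prod>b\<in>Basis. cis ((x \<bullet> b) * (y \<bullet> b)))"
  unfolding euclidean_inner[of x y] cis_conv_exp by (simp add: exp_sum sum_distrib_left)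

lemma fourier_pair_prod:
  fixes g :: "'a::euclidean_space \<Rightarrow> real \<Rightarrow> real"
  assumes p: "\<And>b. b \<in> Basis \<Longrightarrow> fourier_pair (g b) (h b)"
  shows "fourier_pair (\<lambda>x::'a. \<Prod>b\<in>Basis. g b (x \<bullet> b)) (\<lambda>\<xi>. \<Prod>b\<in>Basis. h b (\<xi> \<bullet> b))"
  unfolding fourier_pair_def
proof (intro conjI allI)
  note [simp] = fourier_pairD(1,2)[OF p]
  show "integrable lborel (\<lambda>x::'a. \<Prod>b\<in>Basis. g b (x \<bullet> b))"
    by (rule lborel_integral_prod) auto
  show "integrable lborel (\<lambda>\<xi>::'a. \<Prod>b\<in>Basis. h b (\<xi> \<bullet> b))"
    by (rule lborel_integral_prod) auto
  fix \<xi> x :: 'a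
  have "complex_of_real (\<Prod>b\<in>Basis. g b (y \<bullet> b)) * cis (- (y \<bullet> \<xi>))
    = (\<Prod>b\<in>Basis. complex_of_real (g b (y \<bullet> b)) * cis (- ((y \<bullet> b) \<bullet> (\<xi> \<bullet> b))))" for y
    using cis_inner_eq_prod[of y "- \<xi>"] by (simp add: prod.distrib)
  then have "(LINT y|lborel. complex_of_real (\<Prod>b\<in>Basis. g b (y \<bullet> b)) * cis (- (y \<bullet> \<xi>)))
    = (LINT y|lborel. (\<Prod>b\<in>Basis. complex_of_real (g b (y \<bullet> b)) * cis (- ((y \<bullet> b) \<bullet> (\<xi> \<bullet> b)))))" by simp
  also have "\<dots> = (\<Prod>b\<in>Basis. (LINT t|lborel. complex_of_real (g b t) * cis (- (t \<bullet> (\<xi> \<bullet> b)))))"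
    by (rule lborel_integral_prod) (auto intro!: integrable_mult_cis)
  also have "\<dots> = (\<Prod>b\<in>Basis. h b (\<xi> \<bullet> b))"
    by (intro prod.cong refl) (rule fourier_pairD(3)[OF p])
  finally show "(LINT y|lborel. complex_of_real (\<Prod>b\<in>Basis. g b (y \<bullet> b)) * cis (- (y \<bullet> \<xi>))) = (\<Prod>b\<in>Basis. h b (\<xi> \<bullet> b))" .
  have "(\<Prod>b\<in>Basis. h b (\<xi> \<bullet> b)) * cis (x \<bullet> \<xi>) = (\<Prod>b\<in>Basis. h b (\<xi> \<bullet> b) * cis ((x \<bullet> b) \<bullet> (\<xi> \<bullet> b)))" for \<xi>
    using cis_inner_eq_prod[of x "\<xi>"] by (simp add: prod.distrib)
  then have "(LINT \<xi>|lborel. (\<Prod>b\<in>Basis. h b (\<xi> \<bullet> b)) * cis (x \<bullet> \<xi>))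
    = (LINT \<xi>|lborel. (\<Prod>b\<in>Basis. h b (\<xi> \<bullet> b) * cis ((x \<bullet> b) \<bullet> (\<xi> \<bullet> b))))" by simp
  also have "\<dots> = (\<Prod>b\<in>Basis. (LINT t|lborel. h b t * cis ((x \<bullet> b) \<bullet> t)))"
    by (rule lborel_integral_prod) (auto intro!: integrable_mult_cis)
  also have "\<dots> = (\<Prod>b\<in>(Basis::'a set). of_real ((2 * pi) ^ DIM(real) * g b (x \<bullet> b)))"
    by (intro prod.cong refl) (rule fourier_pairD(4)[OF p])
  also have "\<dots> = of_real ((2 * pi) ^ DIM('a) * (\<Prod>b\<in>Basis. g b (x \<bullet> b)))"
    by (simp add: prod.distrib)
  finally show "(LINT \<xi>|lborel. (\<Prod>b\<in>Basis. h b (\<xi> \<bullet> b)) * cis (x \<bullet> \<xi>))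
    = of_real ((2 * pi) ^ DIM('a) * (\<Prod>b\<in>Basis. g b (x \<bullet> b)))" .
qed

text \<open>Fubini suffices here: no integrability of the multiplier kernel is needed.\<close>

lemma dyadic_block_fourier_pair:
  fixes f :: "'a::euclidean_space \<Rightarrow> real"
  assumes m: "integrable lborel (dyadic_phi phi0 k)" and p: "fourier_pair f H"
  shows "dyadic_block phi0 k f x =
    of_real ((2 * pi) powr (- real DIM('a))) * (LINT \<xi>|lborel. of_real (dyadic_phi phi0 k \<xi>) * H \<xi> * cis (x \<bullet> \<xi>))"
proof -
  let ?m = "dyadic_phi phi0 k" and ?c = "complex_of_real ((2 * pi) powr (- real DIM('a)))"
  have [measurable]: "?m \<in> borel_measurable borel" "f \<in> borel_measurable borel"
    using m fourier_pairD(1)[OF p] by auto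
  have km: "multiplier_kernel ?m \<in> borel_measurable borel"
    unfolding multiplier_kernel_def[abs_def] by measurable
  have "dyadic_block phi0 k f x = (LINT y|lborel. multiplier_kernel ?m (x - y) * complex_of_real (f y))"
    unfolding dyadic_block_def by (rule integral_completion) (use km in measurable)
  also have "\<dots> = ?c * (LINT y|lborel. (LINT \<xi>|lborel. of_real (?m \<xi>) * cis ((x - y) \<bullet> \<xi>) * of_real (f y)))"
    unfolding multiplier_kernel_def
    by (simp only: mult.assoc integral_mult_right_zero integral_mult_left_zero[symmetric])
  also have "(LINT y|lborel. (LINT \<xi>|lborel. of_real (?m \<xi>) * cis ((x - y) \<bullet> \<xi>) * complex_of_real (f y)))
    = (LINT \<xi>|lborel. (LINT y|lborel. of_real (?m \<xi>) * cis ((x - y) \<bullet> \<xi>) * complex_of_real (f y)))"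
  proof (rule lborel_pair.Fubini_integral, rule lborel_pair.Fubini_integrable)
    show "integrable lborel (\<lambda>\<xi>. LINT y|lborel. norm (case (\<xi>, y) of (\<xi>, y) \<Rightarrow> of_real (?m \<xi>) * cis ((x - y) \<bullet> \<xi>) * complex_of_real (f y)))"
      using m by (simp add: norm_mult)
    show "AE \<xi> in lborel. integrable lborel (\<lambda>y. case (\<xi>, y) of (\<xi>, y) \<Rightarrow> of_real (?m \<xi>) * cis ((x - y) \<bullet> \<xi>) * complex_of_real (f y))"
    proof (rule AE_I2, simp only: prod.case)
      fix \<xi> show "integrable lborel (\<lambda>y. of_real (?m \<xi>) * cis ((x - y) \<bullet> \<xi>) * complex_of_real (f y))"
        by (rule Bochner_Integration.integrable_bound[OF integrable_mult_right[OF fourier_pairD(1)[OF p], of "?m \<xi>"]])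
           (auto simp: norm_mult)
    qed
  qed (simp add: split_beta')
  also have "\<dots> = (LINT \<xi>|lborel. of_real (?m \<xi>) * H \<xi> * cis (x \<bullet> \<xi>))"
  proof (rule Bochner_Integration.integral_cong[OF refl])
    fix \<xi>
    have "of_real (?m \<xi>) * cis ((x - y) \<bullet> \<xi>) * complex_of_real (f y)
      = (of_real (?m \<xi>) * cis (x \<bullet> \<xi>)) * (of_real (f y) * cis (- (y \<bullet> \<xi>)))" for y
    proof -
      have "cis ((x - y) \<bullet> \<xi>) = cis (x \<bullet> \<xi>) * cis (- (y \<bullet> \<xi>))"
        by (simp add: inner_diff_left cis_mult)
      then show ?thesis by (simp add: ac_simps)
    qed
    then have "(LINT y|lborel. of_real (?m \<xi>) * cis ((x - y) \<bullet> \<xi>) * complex_of_real (f y))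
      = (of_real (?m \<xi>) * cis (x \<bullet> \<xi>)) * (LINT y|lborel. of_real (f y) * cis (- (y \<bullet> \<xi>)))"
      by (simp only: integral_mult_right_zero)
    then show "(LINT y|lborel. of_real (?m \<xi>) * cis ((x - y) \<bullet> \<xi>) * complex_of_real (f y)) = of_real (?m \<xi>) * H \<xi> * cis (x \<bullet> \<xi>)"
      by (simp add: fourier_pairD(3)[OF p] ac_simps)
  qed
  finally show ?thesis .
qed

section \<open>Functions with a single Littlewood-Paley block\<close>

lemma enn_powr_le:
  assumes "x \<le> ennreal y" "0 \<le> y" "0 \<le> a"
  shows "enn_powr x a \<le> ennreal (y powr a)"
proof -
  have x: "x \<noteq> \<infinity>" using assms(1) by (auto simp: top_unique)
  have "enn2real x \<le> y" using enn2real_leI[OF assms(2,1)] .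
  then show ?thesis using x assms by (simp add: enn_powr_def ennreal_leI powr_mono2)
qed

lemma one_le_enn2real:
  assumes "1 \<le> p" "p \<noteq> \<infinity>" shows "1 \<le> enn2real p"
  using enn2real_mono[of 1 p] assms by (simp add: less_top)

text \<open>Interpolation between the two end points: \<bar>f\<bar>^r \<le> B^(r-1) \<bar>f\<bar>
  pointwise, so a common bound for the L1 norm and the supremum passes to every exponent with the
  same constant.\<close>

lemma Lp_norm_lebesgue_le:
  fixes f :: "'a::euclidean_space \<Rightarrow> real"
  assumes f: "integrable lborel f" and B: "0 < B" and sup: "\<And>x. \<bar>f x\<bar> \<le> B"
    and L1: "(LINT x|lborel. \<bar>f x\<bar>) \<le> B" and p: "1 \<le> p"
  shows "Lp_norm lebesgue p f \<le> ennreal B"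
proof (cases "p = \<infinity>")
  case True
  have fm: "f \<in> borel_measurable lebesgue" using f by (intro measurable_completion) auto
  have "esssup lebesgue (\<lambda>x. ereal (norm (f x))) \<le> ereal B"
    using sup fm by (intro esssup_I) auto
  then have "e2ennreal (esssup lebesgue (\<lambda>x. ereal (norm (f x)))) \<le> e2ennreal (ereal B)"
    by (rule e2ennreal_mono)
  then show ?thesis by (simp add: Lp_norm_def True)
next
  case False
  define r where "r = enn2real p"
  have r: "1 \<le> r" unfolding r_def using p False by (rule one_le_enn2real)
  have [measurable]: "f \<in> borel_measurable borel" using f by auto
  have "(\<integral>\<^sup>+ x. ennreal (norm (f x) powr r) \<partial>lebesgue) = (\<integral>\<^sup>+ x. ennreal (norm (f x) powr r) \<partial>lborel)"
    by (rule nn_integral_completion)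
  also have "\<dots> \<le> (\<integral>\<^sup>+ x. ennreal (B powr (r - 1) * \<bar>f x\<bar>) \<partial>lborel)"
  proof (intro nn_integral_mono ennreal_leI)
    fix x
    have "norm (f x) powr r = \<bar>f x\<bar> powr (r - 1) * \<bar>f x\<bar>"
      using powr_add[of "\<bar>f x\<bar>" "r - 1" 1] by simp
    also have "\<dots> \<le> B powr (r - 1) * \<bar>f x\<bar>"
      using sup[of x] r by (intro mult_right_mono powr_mono2) auto
    finally show "norm (f x) powr r \<le> B powr (r - 1) * \<bar>f x\<bar>" .
  qed
  also have "\<dots> = ennreal (B powr (r - 1) * (LINT x|lborel. \<bar>f x\<bar>))"
    using f by (subst nn_integral_eq_integral) auto
  also have "\<dots> \<le> ennreal (B powr (r - 1) * B)"
    using L1 by (intro ennreal_leI mult_left_mono) auto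
  also have "B powr (r - 1) * B = B powr r"
    using B powr_add[of B "r - 1" 1] by simp
  finally have "enn_powr (\<integral>\<^sup>+ x. ennreal (norm (f x) powr r) \<partial>lebesgue) (1 / r) \<le> ennreal ((B powr r) powr (1 / r))"
    using r by (intro enn_powr_le) auto
  also have "(B powr r) powr (1 / r) = B" using r B by (simp add: powr_powr)
  finally show ?thesis using False by (simp add: Lp_norm_def r_def)
qed

lemma Lp_norm_of_real: "Lp_norm M p (\<lambda>x. complex_of_real (f x)) = Lp_norm M p f"
  by (simp add: Lp_norm_def)

lemma Lp_norm_zero:
  assumes "1 \<le> p"
  shows "Lp_norm lebesgue p (\<lambda>x::'a::euclidean_space. 0::complex) = 0"
proof -
  have "Lp_norm lebesgue p (\<lambda>x::'a. 0::real) \<le> 0"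
    \<comment> \<open>The interpolation bound asks for a positive \<open>B\<close>, so the zero
      function is tested against every positive real.\<close>
    by (rule ennreal_le_epsilon) (use assms in \<open>auto intro: Lp_norm_lebesgue_le\<close>)
  then show ?thesis using Lp_norm_of_real[of lebesgue p "\<lambda>x::'a. 0"] by simp
qed

text \<open>With one nonzero term the sequence norm is that term, whatever q is, and the size
  assumed for \<open>f\<close> cancels its weight 2^(ms).\<close>

lemma besov_norm_single_block:
  fixes f :: "'a::euclidean_space \<Rightarrow> real"
  assumes p: "1 \<le> p" and q: "1 \<le> q"
    and block: "\<And>k x. dyadic_block phi0 k f x = (if k = m then of_real (f x) else 0)"
    and f: "Lp_norm lebesgue p f \<le> ennreal (2 powr - (real m * s))"
  shows "besov_norm phi0 s p q f \<le> 1"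
proof -
  have b: "dyadic_block phi0 m f = (\<lambda>x. of_real (f x))"
    "k \<noteq> m \<Longrightarrow> dyadic_block phi0 k f = (\<lambda>x. 0)" for k
    by (auto simp: block)
  have N: "Lp_norm lebesgue p (dyadic_block phi0 m f) \<le> ennreal (2 powr - (real m * s))"
    using f by (simp add: b Lp_norm_of_real)
  have Z: "Lp_norm lebesgue p (dyadic_block phi0 k f) = 0" if "k \<noteq> m" for k
    using that by (simp add: b Lp_norm_zero[OF p])
  show ?thesis
  proof (cases "q = \<infinity>")
    case True
    have "ennreal (2 powr (real k * s)) * Lp_norm lebesgue p (dyadic_block phi0 k f) \<le> 1" for k
    proof (cases "k = m")
      case True
      have "ennreal (2 powr (real m * s)) * Lp_norm lebesgue p (dyadic_block phi0 m f)
        \<le> ennreal (2 powr (real m * s)) * ennreal (2 powr - (real m * s))"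
        by (intro mult_left_mono N) auto
      also have "\<dots> = 1" by (simp add: ennreal_mult[symmetric] powr_add[symmetric])
      finally show ?thesis using True by simp
    qed (simp add: Z)
    then show ?thesis using True by (simp add: besov_norm_def SUP_least)
  next
    case False
    define r where "r = enn2real q"
    have r: "1 \<le> r" unfolding r_def using q False by (rule one_le_enn2real)
    let ?t = "\<lambda>k. ennreal (2 powr (real k * s * r)) * enn_powr (Lp_norm lebesgue p (dyadic_block phi0 k f)) r"
    have "?t k = 0" if "k \<noteq> m" for k
      using r Z[OF that] by (simp add: enn_powr_def)
    then have "(\<Sum>k. ?t k) = ?t m"
      using suminf_finite[of "{m}" ?t] by auto
    also have "\<dots> \<le> ennreal (2 powr (real m * s * r)) * ennreal ((2 powr - (real m * s)) powr r)"
      using r by (intro mult_left_mono enn_powr_le N) auto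
    also have "\<dots> = ennreal 1"
      by (simp add: ennreal_mult[symmetric] powr_powr powr_add[symmetric])
    finally have "enn_powr (\<Sum>k. ?t k) (1 / r) \<le> ennreal (1 powr (1 / r))"
      using r by (intro enn_powr_le) auto
    then show ?thesis using False by (simp add: besov_norm_def r_def)
  qed
qed

section \<open>Dyadic cutoffs on an annulus\<close>

lemma C_infinity_continuous: "C_infinity f \<Longrightarrow> continuous_on UNIV f"
  using Ck.simps(1) unfolding C_infinity_def by blast

lemma integrable_continuous_bounded_support:
  fixes f :: "'a::euclidean_space \<Rightarrow> real"
  assumes "continuous_on UNIV f" "\<And>x. K < norm x \<Longrightarrow> f x = 0"
  shows "integrable lborel f"
proof -
  have "integrable lborel (\<lambda>x. indicator (cball 0 K) x *\<^sub>R f x)"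
    using assms(1) by (intro borel_integrable_compact) (auto intro: continuous_on_subset)
  moreover have "(\<lambda>x. indicator (cball 0 K) x *\<^sub>R f x) = f"
    using assms(2) by (auto simp: indicator_def fun_eq_iff)
  ultimately show ?thesis by simp
qed

lemma integrable_dyadic_phi:
  fixes phi0 :: "'a::euclidean_space \<Rightarrow> real"
  assumes c: "continuous_on UNIV phi0" and z: "\<forall>x. norm x \<ge> 3/2 \<longrightarrow> phi0 x = 0"
  shows "integrable lborel (dyadic_phi phi0 k)"
proof -
  have i: "integrable lborel (\<lambda>x. phi0 (a *\<^sub>R x))" if a: "0 < a" for a
  proof (rule integrable_continuous_bounded_support[where K="3 / 2 / a"])
    show "continuous_on UNIV (\<lambda>x. phi0 (a *\<^sub>R x))"
      by (intro continuous_on_compose2[OF c] continuous_intros) auto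
    show "phi0 (a *\<^sub>R x) = 0" if "3 / 2 / a < norm x" for x
      using z that a by (auto simp: field_simps)
  qed
  show ?thesis
    using i[of 1] i[of "(1/2) ^ k"] i[of "(1/2) ^ (k - 1)"]
    by (cases "k = 0") (auto simp: dyadic_phi_def[abs_def])
qed

text \<open>Along i, the value of \<open>phi0\<close> at (1/2)^i \<xi> jumps from 0 for i \<le> j to
  1 for i > j. The cutoffs are the initial value and the successive differences of this sequence, so
  only the difference across the jump survives.\<close>

lemma dyadic_phi_annulus:
  assumes one: "\<forall>x. norm x \<le> 1 \<longrightarrow> phi0 x = 1" and z: "\<forall>x. norm x \<ge> 3/2 \<longrightarrow> phi0 x = 0"
    and lo: "3/2 * 2 ^ j \<le> norm \<xi>" and hi: "norm \<xi> \<le> 2 * 2 ^ j"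
  shows "dyadic_phi phi0 k \<xi> = (if k = Suc j then 1 else 0)"
proof -
  have 1: "phi0 ((1/2) ^ i *\<^sub>R \<xi>) = 1" if "j < i" for i
  proof -
    have "norm \<xi> \<le> 2 ^ Suc j" using hi by simp
    also have "\<dots> \<le> 2 ^ i" using that by (intro power_increasing) auto
    finally show ?thesis using one by (simp add: power_divide divide_le_eq)
  qed
  have zero: "phi0 ((1/2) ^ i *\<^sub>R \<xi>) = 0" if "i \<le> j" for i
  proof -
    have "3/2 * 2 ^ i \<le> 3/2 * (2 ^ j :: real)" using that by (intro mult_left_mono power_increasing) auto
    also note lo
    finally show ?thesis using z by (simp add: power_divide le_divide_eq)
  qed
  show ?thesis
  proof (cases k)
    case 0
    then show ?thesis using zero[of 0] by (simp add: dyadic_phi_def)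
  next
    case (Suc i)
    consider "i < j" | "i = j" | "j < i" by linarith
    then show ?thesis
      using zero[of i] zero[of "Suc i"] 1[of i] 1[of "Suc i"] by cases (auto simp: dyadic_phi_def Suc)
  qed
qed

text \<open>On the spectrum of \<open>f\<close> the multiplier is the constant 0 or 1. In the second
  case the inversion contained in \<open>fourier_pair\<close> returns \<open>f\<close>, and the
  powers of 2 pi cancel.\<close>

lemma dyadic_block_annulus:
  fixes f :: "'a::euclidean_space \<Rightarrow> real"
  assumes c: "continuous_on UNIV phi0"
    and one: "\<forall>x. norm x \<le> 1 \<longrightarrow> phi0 x = 1" and z: "\<forall>x. norm x \<ge> 3/2 \<longrightarrow> phi0 x = 0"
    and p: "fourier_pair f H"
    and supp: "\<And>\<xi>. H \<xi> \<noteq> 0 \<Longrightarrow> 3/2 * 2 ^ j \<le> norm \<xi> \<and> norm \<xi> \<le> 2 * 2 ^ j"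
  shows "dyadic_block phi0 k f x = (if k = Suc j then of_real (f x) else 0)"
proof -
  have "of_real (dyadic_phi phi0 k \<xi>) * H \<xi> * cis (x \<bullet> \<xi>) = (if k = Suc j then 1 else 0) * (H \<xi> * cis (x \<bullet> \<xi>))" for \<xi>
    using dyadic_phi_annulus[OF one z, of j \<xi> k] supp[of \<xi>] by (cases "H \<xi> = 0") auto
  then have "dyadic_block phi0 k f x = of_real ((2 * pi) powr (- real DIM('a))) * ((if k = Suc j then 1 else 0) * of_real ((2 * pi) ^ DIM('a) * f x))"
    by (simp only: dyadic_block_fourier_pair[OF integrable_dyadic_phi[OF c z] p] integral_mult_right_zero
      fourier_pairD(4)[OF p])
  moreover have "(2 * pi) powr (- real DIM('a)) * (2 * pi) ^ DIM('a) = 1"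
  proof -
    have "(2 * pi) powr (- real DIM('a)) = inverse ((2 * pi) ^ DIM('a))"
      by (simp add: powr_minus powr_realpow)
    then show ?thesis by (simp only:, intro left_inverse) simp
  qed
  ultimately show ?thesis
    by (simp add: mult.assoc[symmetric] flip: of_real_mult of_real_power)
qed

section \<open>Lattice sums\<close>

text \<open>The tensor window at scale 1/R centered at x0 + n/R. The argument, R times a coordinate
  of x - x0 minus \<open>n b\<close>, is expanded into the form c t + a of
  \<open>fourier_pair_real_affine\<close>.\<close>

definition lattice_atom :: "(real \<Rightarrow> real) \<Rightarrow> real \<Rightarrow> 'a::euclidean_space \<Rightarrow> ('a \<Rightarrow> nat) \<Rightarrow> 'a \<Rightarrow> real" where
  "lattice_atom g R x0 n x = (\<Prod>b\<in>Basis. g (R * (x \<bullet> b) + (- (R * (x0 \<bullet> b)) - real (n b))))"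

text \<open>Extensional functions make the index set finite, with M^d elements. The corresponding
  centers fill a cube with corner \<open>x0\<close>.\<close>

definition lattice_box :: "nat \<Rightarrow> ('a::euclidean_space \<Rightarrow> nat) set" where
  "lattice_box M = (\<Pi>\<^sub>E b\<in>Basis. {..<M})"

lemma finite_lattice_box [simp]: "finite (lattice_box M)"
  by (simp add: lattice_box_def finite_PiE)

lemma card_lattice_box: "card (lattice_box M :: ('a::euclidean_space \<Rightarrow> nat) set) = M ^ DIM('a)"
  by (simp add: lattice_box_def card_PiE)

lemma norm_between_coordinates:
  fixes x :: "'a::euclidean_space" and lo hi :: real
  assumes lo: "0 \<le> lo" and x: "\<And>b. b \<in> Basis \<Longrightarrow> lo \<le> \<bar>x \<bullet> b\<bar> \<and> \<bar>x \<bullet> b\<bar> \<le> hi"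
  shows "sqrt DIM('a) * lo \<le> norm x" "norm x \<le> sqrt DIM('a) * hi"
proof -
  have hi: "0 \<le> hi" using x[OF SOME_Basis] by linarith
  have n: "(norm x)\<^sup>2 = (\<Sum>b\<in>Basis. (\<bar>x \<bullet> b\<bar>)\<^sup>2)"
    unfolding power2_norm_eq_inner by (subst euclidean_inner) (simp add: power2_eq_square)
  have "(\<Sum>b\<in>(Basis::'a set). lo\<^sup>2) \<le> (\<Sum>b\<in>Basis. (\<bar>x \<bullet> b\<bar>)\<^sup>2)"
    using x lo by (intro sum_mono power_mono) auto
  then have "(sqrt DIM('a) * lo)\<^sup>2 \<le> (norm x)\<^sup>2" by (simp add: n power_mult_distrib)
  then show "sqrt DIM('a) * lo \<le> norm x" by (rule power2_le_imp_le) simp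
  have "(\<Sum>b\<in>Basis. (\<bar>x \<bullet> b\<bar>)\<^sup>2) \<le> (\<Sum>b\<in>(Basis::'a set). hi\<^sup>2)"
    using x lo by (intro sum_mono power_mono) auto
  then have "(norm x)\<^sup>2 \<le> (sqrt DIM('a) * hi)\<^sup>2" by (simp add: n power_mult_distrib)
  then show "norm x \<le> sqrt DIM('a) * hi" by (rule power2_le_imp_le) (simp add: hi)
qed

text \<open>Translation only adds phases, so the spectrum is confined by \<open>R\<close> alone,
  independently of \<open>x0\<close> and \<open>n\<close>. Every coordinate of a frequency in it has
  modulus between lo R and hi R, which gives the norm the factor sqrt d.\<close>

lemma fourier_pair_lattice_atom:
  fixes x0 :: "'a::euclidean_space" and R lo hi :: real
  assumes g: "fourier_pair g h" and R: "0 < R" and lo: "0 \<le> lo"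
    and h: "\<And>\<tau>. h \<tau> \<noteq> 0 \<Longrightarrow> lo \<le> \<bar>\<tau>\<bar> \<and> \<bar>\<tau>\<bar> \<le> hi"
  obtains H where "fourier_pair (lattice_atom g R x0 n) H"
    "\<And>\<xi>. H \<xi> \<noteq> 0 \<Longrightarrow> sqrt DIM('a) * lo * R \<le> norm \<xi> \<and> norm \<xi> \<le> sqrt DIM('a) * hi * R"
proof
  let ?a = "\<lambda>b. - (R * (x0 \<bullet> b)) - real (n b)"
  let ?H = "\<lambda>\<xi>::'a. \<Prod>b\<in>Basis. of_real (1 / R) * (h (\<xi> \<bullet> b / R) * cis (\<xi> \<bullet> b / R * ?a b))"
  show "fourier_pair (lattice_atom g R x0 n) ?H"
    unfolding lattice_atom_def[abs_def]
    by (rule fourier_pair_prod[where g="\<lambda>b t. g (R * t + ?a b)"]) (rule fourier_pair_real_affine[OF g R])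
  fix \<xi> assume "?H \<xi> \<noteq> 0"
  then have "h (\<xi> \<bullet> b / R) \<noteq> 0" if "b \<in> Basis" for b using that by auto
  then have "lo * R \<le> \<bar>\<xi> \<bullet> b\<bar> \<and> \<bar>\<xi> \<bullet> b\<bar> \<le> hi * R" if "b \<in> Basis" for b
    using h[of "\<xi> \<bullet> b / R"] that R by (auto simp: field_simps)
  from norm_between_coordinates[OF _ this] lo R
  show "sqrt DIM('a) * lo * R \<le> norm \<xi> \<and> norm \<xi> \<le> sqrt DIM('a) * hi * R"
    by (auto simp: mult.assoc)
qed

lemma integral_abs_lattice_atom:
  fixes x0 :: "'a::euclidean_space" and R :: real
  assumes g: "integrable lborel g" and R: "0 < R"
  shows "(LINT x|lborel. \<bar>lattice_atom g R x0 n x\<bar>) = ((LINT t|lborel. \<bar>g t\<bar>) / R) ^ DIM('a)"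
proof -
  let ?a = "\<lambda>b. - (R * (x0 \<bullet> b)) - real (n b)"
  have i: "integrable lborel (\<lambda>t. \<bar>g (R * t + a)\<bar>)" for a
    using lborel_integrable_real_affine[of g R a] R g by (simp add: add.commute)
  have e: "(LINT t|lborel. \<bar>g (R * t + a)\<bar>) = (LINT t|lborel. \<bar>g t\<bar>) / R" for a
    using R by (subst (2) lborel_integral_real_affine[where c=R and t=a]) (auto simp: add.commute)
  have "(LINT x|lborel. \<bar>lattice_atom g R x0 n x\<bar>) = (LINT x|lborel. (\<Prod>b\<in>Basis. \<bar>g (R * ((x::'a) \<bullet> b) + ?a b)\<bar>))"
    by (simp add: lattice_atom_def abs_prod)
  also have "\<dots> = (\<Prod>b\<in>(Basis::'a set). LINT t|lborel. \<bar>g (R * t + ?a b)\<bar>)"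
    by (rule lborel_integral_prod(2)) (rule i)
  also have "\<dots> = ((LINT t|lborel. \<bar>g t\<bar>) / R) ^ DIM('a)" by (simp add: e)
  finally show ?thesis .
qed

text \<open>The sum over the box of tensor products factors into one-dimensional sums, each bounded
  independently of \<open>M\<close>, \<open>R\<close> and \<open>x\<close> by the quadratic decay of
  \<open>g\<close>.\<close>

lemma sum_abs_lattice_atom_le:
  fixes x0 x :: "'a::euclidean_space" and C R :: real
  assumes C: "0 \<le> C" and g: "\<And>t. \<bar>g t\<bar> \<le> C / (1 + t\<^sup>2)"
  shows "(\<Sum>n\<in>lattice_box M. \<bar>lattice_atom g R x0 n x\<bar>) \<le> (C * (3 * pi)) ^ DIM('a)"
proof -
  let ?y = "\<lambda>b. R * (x \<bullet> b) - R * (x0 \<bullet> b)"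
  have 1: "(\<Sum>k<M. \<bar>g (?y b - real k)\<bar>) \<le> C * (3 * pi)" for b
  proof -
    have "(\<Sum>k<M. \<bar>g (?y b - real k)\<bar>) \<le> (\<Sum>k<M. C * (1 / (1 + (?y b - real k)\<^sup>2)))"
      using g by (intro sum_mono) auto
    also have "\<dots> = C * (\<Sum>k<M. 1 / (1 + (?y b - real k)\<^sup>2))" by (simp only: sum_distrib_left)
    also have "\<dots> \<le> C * (3 * pi)" by (intro mult_left_mono sum_shifted_inverse_squares_le C)
    finally show ?thesis .
  qed
  have "(\<Sum>n\<in>lattice_box M. \<bar>lattice_atom g R x0 n x\<bar>) = (\<Sum>n\<in>lattice_box M. \<Prod>b\<in>Basis. \<bar>g (?y b - real (n b))\<bar>)"
    by (simp add: lattice_atom_def abs_prod algebra_simps)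
  also have "\<dots> = (\<Prod>b\<in>Basis. \<Sum>k<M. \<bar>g (?y b - real k)\<bar>)"
    unfolding lattice_box_def by (rule prod_sum_PiE[symmetric]) auto
  also have "\<dots> \<le> (\<Prod>b\<in>(Basis::'a set). C * (3 * pi))"
    by (intro prod_mono conjI 1 sum_nonneg) auto
  finally show ?thesis by simp
qed

text \<open>Since \<open>\<phi>\<^sub>k\<close> equals 1 on the annulus \<open>3/2 * 2 ^ j \<le> norm \<xi> \<le> 2 * 2 ^ j\<close> for \<open>k = Suc j\<close> and 0 there
  for all other \<open>k\<close>, the Besov norm of the sums below reduces to their \<open>L\<^sup>p\<close> norm.\<close>

lemma lattice_sums_in_besov_unit_ball:
  fixes phi0 :: "'a::euclidean_space \<Rightarrow> real" and g :: "real \<Rightarrow> real" and s C \<kappa> :: real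
  assumes c: "continuous_on UNIV phi0"
    and one: "\<forall>x. norm x \<le> 1 \<longrightarrow> phi0 x = 1" and z: "\<forall>x. norm x \<ge> 3/2 \<longrightarrow> phi0 x = 0"
    and p: "1 \<le> p" and q: "1 \<le> q"
    and C: "0 \<le> C" and gC: "\<And>t. \<bar>g t\<bar> \<le> C / (1 + t\<^sup>2)" and gh: "fourier_pair g h"
    and h: "\<And>\<tau>. h \<tau> \<noteq> 0 \<Longrightarrow> 3/2 / sqrt DIM('a) \<le> \<bar>\<tau>\<bar> \<and> \<bar>\<tau>\<bar> \<le> 2 / sqrt DIM('a)"
    and \<kappa>: "0 \<le> \<kappa>"
  obtains B where "0 < B"
    "\<And>j M x0 \<epsilon>. real M \<le> \<kappa> * 2 ^ j \<Longrightarrow> (\<And>n. \<bar>\<epsilon> n\<bar> \<le> 1) \<Longrightarrow>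
      (\<lambda>x. \<Sum>n\<in>lattice_box M. (2 powr - (real (Suc j) * s) / B * \<epsilon> n) * lattice_atom g (2 ^ j) x0 n x)
      \<in> besov_unit_ball phi0 s p q"
proof -
  define L where "L = (LINT t|lborel. \<bar>g t\<bar>)"
  \<comment> \<open>The second summand bounds the sum of the moduli of all atoms at any point. The
    third bounds their total L1 norm M^d (L/R)^d, since M \<le> \<kappa> R. The summand 1 ensures
    positivity.\<close>
  define B where "B = 1 + (C * (3 * pi)) ^ DIM('a) + (\<kappa> * L) ^ DIM('a)"
  have L: "0 \<le> L" by (simp add: L_def)
  have B: "0 < B" "(C * (3 * pi)) ^ DIM('a) \<le> B" "(\<kappa> * L) ^ DIM('a) \<le> B"
    using C \<kappa> L by (auto simp: B_def add_pos_nonneg)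
  show thesis
  proof
    show "0 < B" by fact
    fix j M :: nat and x0 :: 'a and \<epsilon> :: "('a \<Rightarrow> nat) \<Rightarrow> real"
    assume M: "real M \<le> \<kappa> * 2 ^ j" and \<epsilon>: "\<And>n. \<bar>\<epsilon> n\<bar> \<le> 1"
    define R :: real where "R = 2 ^ j"
    define S where "S = 2 powr - (real (Suc j) * s)"
    have R: "0 < R" and S: "0 < S" by (auto simp: R_def S_def)
    define a where "a n = S / B * \<epsilon> n" for n
    have a: "\<bar>a n\<bar> \<le> S / B" for n
    proof -
      have "\<bar>a n\<bar> = S / B * \<bar>\<epsilon> n\<bar>" using S B(1) by (simp add: a_def abs_mult)
      also have "\<dots> \<le> S / B * 1" using S B(1) \<epsilon> by (intro mult_left_mono) auto
      finally show ?thesis by simp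
    qed
    let ?f = "\<lambda>x. \<Sum>n\<in>lattice_box M. a n * lattice_atom g R x0 n x"
    have "\<exists>H. fourier_pair (lattice_atom g R x0 n) H \<and> (\<forall>\<xi>. H \<xi> \<noteq> 0 \<longrightarrow>
        sqrt DIM('a) * (3/2 / sqrt DIM('a)) * R \<le> norm \<xi> \<and> norm \<xi> \<le> sqrt DIM('a) * (2 / sqrt DIM('a)) * R)" for n
      by (rule fourier_pair_lattice_atom[OF gh R _ h, where ?x0.0=x0 and n=n]) auto
    then obtain H where H: "fourier_pair (lattice_atom g R x0 n) (H n)"
      and supp: "H n \<xi> \<noteq> 0 \<Longrightarrow> sqrt DIM('a) * (3/2 / sqrt DIM('a)) * R \<le> norm \<xi> \<and> norm \<xi> \<le> sqrt DIM('a) * (2 / sqrt DIM('a)) * R" for n \<xi>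
      by metis
    let ?H = "\<lambda>\<xi>. \<Sum>n\<in>lattice_box M. of_real (a n) * H n \<xi>"
    have pair: "fourier_pair ?f ?H"
      by (rule fourier_pair_sum[of "lattice_box M" "lattice_atom g R x0" H a, OF finite_lattice_box H])
    have block: "dyadic_block phi0 k ?f x = (if k = Suc j then of_real (?f x) else 0)" for k x
    proof (rule dyadic_block_annulus[OF c one z pair])
      fix \<xi> assume "?H \<xi> \<noteq> 0"
      then obtain n where "complex_of_real (a n) * H n \<xi> \<noteq> 0"
        by (rule sum.not_neutral_contains_not_neutral)
      then have "H n \<xi> \<noteq> 0" by auto
      from supp[OF this] show "3/2 * 2 ^ j \<le> norm \<xi> \<and> norm \<xi> \<le> 2 * 2 ^ j" by (simp add: R_def)
    qed
    have pt: "\<bar>?f x\<bar> \<le> S / B * (\<Sum>n\<in>lattice_box M. \<bar>lattice_atom g R x0 n x\<bar>)" for x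
      unfolding sum_distrib_left
      by (rule order_trans[OF sum_abs]) (intro sum_mono, simp only: abs_mult, intro mult_right_mono a abs_ge_zero)
    have sup: "\<bar>?f x\<bar> \<le> S" for x
    proof -
      note pt
      also have "S / B * (\<Sum>n\<in>lattice_box M. \<bar>lattice_atom g R x0 n x\<bar>) \<le> S / B * B"
        using S B by (intro mult_left_mono order_trans[OF sum_abs_lattice_atom_le[OF C gC] B(2)]) auto
      finally show ?thesis using B(1) by simp
    qed
    have int: "integrable lborel (lattice_atom g R x0 n)" for n by (rule fourier_pairD(1)[OF H])
    have "(LINT x|lborel. \<bar>?f x\<bar>) \<le> (LINT x|lborel. S / B * (\<Sum>n\<in>lattice_box M. \<bar>lattice_atom g R x0 n x\<bar>))"
      using fourier_pairD(1)[OF pair] int pt by (intro integral_mono) auto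
    also have "\<dots> = S / B * (\<Sum>n\<in>lattice_box M. LINT x|lborel. \<bar>lattice_atom g R x0 n x\<bar>)"
      using int by (simp add: Bochner_Integration.integral_sum)
    also have "\<dots> = S / B * (real M * (L / R)) ^ DIM('a)"
      by (simp add: integral_abs_lattice_atom[OF fourier_pairD(1)[OF gh] R] card_lattice_box L_def power_mult_distrib power_divide)
    also have "\<dots> \<le> S / B * (\<kappa> * L) ^ DIM('a)"
    proof (intro mult_left_mono power_mono)
      have "real M * (L / R) \<le> (\<kappa> * R) * (L / R)"
        using M L R by (intro mult_right_mono) (auto simp: R_def)
      then show "real M * (L / R) \<le> \<kappa> * L" using R by simp
    qed (use L R S B in auto)
    also have "\<dots> \<le> S / B * B" using S B by (intro mult_left_mono) auto
    finally have L1: "(LINT x|lborel. \<bar>?f x\<bar>) \<le> S" using B(1) by simp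
    have Lp: "Lp_norm lebesgue p ?f \<le> ennreal S"
      by (rule Lp_norm_lebesgue_le[OF fourier_pairD(1)[OF pair] S sup L1 p])
    have "besov_norm phi0 s p q ?f \<le> 1"
      by (rule besov_norm_single_block[OF p q block Lp[unfolded S_def]])
    moreover have "?f \<in> borel_measurable lebesgue"
      using fourier_pairD(1)[OF pair] by (intro measurable_completion) auto
    moreover have "Lp_norm lebesgue p ?f < \<infinity>"
      using Lp by (rule le_less_trans) simp
    ultimately have "?f \<in> besov_unit_ball phi0 s p q"
      unfolding besov_unit_ball_def by blast
    then show "(\<lambda>x. \<Sum>n\<in>lattice_box M. (2 powr - (real (Suc j) * s) / B * \<epsilon> n) * lattice_atom g (2 ^ j) x0 n x)
      \<in> besov_unit_ball phi0 s p q"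
      unfolding a_def S_def R_def .
  qed
qed

section \<open>Gaussian processes\<close>

text \<open>If \<open>K\<close> dominated all the sums, then \<open>T j = min (sum / scale) 1\<close> would tend to 0 almost surely, whereas
  by concavity of \<open>\<lambda>t. min t 1\<close> its mean is at least that of \<open>min \<bar>N\<bar> 1\<close> for a standard normal \<open>N\<close>.\<close>

lemma (in prob_space) gaussian_sums_not_dominated:
  fixes X :: "nat \<Rightarrow> 'i \<Rightarrow> 'a \<Rightarrow> real" and K :: "'a \<Rightarrow> real"
  assumes fin: "\<And>j. finite (I j)"
    and pos: "\<And>j i. i \<in> I j \<Longrightarrow> 0 < \<sigma> j i"
    and X: "\<And>j i. i \<in> I j \<Longrightarrow> distributed M lborel (X j i) (normal_density 0 (\<sigma> j i))"
    and lim: "filterlim (\<lambda>j. \<Sum>i\<in>I j. \<sigma> j i) at_top sequentially"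
    and K: "AE \<omega> in M. \<forall>j. (\<Sum>i\<in>I j. \<bar>X j i \<omega>\<bar>) \<le> K \<omega>"
  shows False
proof -
  define c0 where "c0 = (LINT x|lborel. std_normal_density x * min \<bar>x\<bar> 1)"
  define W where "W j = (\<Sum>i\<in>I j. \<sigma> j i)" for j
  \<comment> \<open>\<open>K\<close> is an arbitrary function, so it enters only pathwise, in the
    limit; what is integrated are the measurable truncated sums, bounded by 1.\<close>
  define T where "T j \<omega> = min ((\<Sum>i\<in>I j. \<bar>X j i \<omega>\<bar>) / W j) 1" for j \<omega>
  have [measurable]: "X j i \<in> borel_measurable M" if "i \<in> I j" for i j
    using X[OF that] by (simp add: distributed_def)
  have mean: "expectation (\<lambda>\<omega>. min (\<bar>X j i \<omega>\<bar> / \<sigma> j i) 1) = c0" if "i \<in> I j" for i j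
  proof -
    have "distributed M lborel (\<lambda>\<omega>. (X j i \<omega> - 0) / \<sigma> j i) std_normal_density"
      using normal_standard_normal_convert[OF pos[OF that], of "X j i" 0] X[OF that] by simp
    from distributed_integral[OF this, of "\<lambda>x. min \<bar>x\<bar> 1"] pos[OF that]
    show ?thesis by (simp add: c0_def abs_divide)
  qed
  have int0: "integrable lborel (\<lambda>x::real. std_normal_density x * min \<bar>x\<bar> 1)"
    by (rule Bochner_Integration.integrable_bound[OF integrable_normal_density[of 1 0]])
       (auto simp: abs_mult intro!: mult_left_le)
  have c0: "0 < c0"
  proof -
    have "c0 \<noteq> 0"
    proof
      assume "c0 = 0"
      then have "AE x in lborel. std_normal_density x * min \<bar>x\<bar> 1 = 0"
        unfolding c0_def by (subst (asm) integral_nonneg_eq_0_iff_AE[OF int0]) auto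
      then have "AE x in lborel. x = (0::real)"
        by eventually_elim (auto simp: normal_density_def min_def split: if_splits)
      with AE_lborel_singleton[of "0::real"] have "AE x in (lborel::real measure). False"
        by eventually_elim simp
      then have "emeasure lborel (UNIV :: real set) = 0"
        by (subst (asm) AE_iff_measurable[of UNIV]) auto
      then show False by simp
    qed
    moreover have "0 \<le> c0" unfolding c0_def by (intro Bochner_Integration.integral_nonneg) auto
    ultimately show ?thesis by simp
  qed
  have Wlim: "filterlim W at_top sequentially" using lim unfolding W_def[abs_def] .
  have Tm: "T j \<in> borel_measurable M" for j unfolding T_def[abs_def] by measurable
  have W0: "0 \<le> W j" for j unfolding W_def using pos by (intro sum_nonneg) (auto intro: less_imp_le)
  have T0: "0 \<le> T j \<omega>" "T j \<omega> \<le> 1" for j \<omega> using W0 by (auto simp: T_def sum_nonneg)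
  have "(\<lambda>j. expectation (T j)) \<longlonglongrightarrow> expectation (\<lambda>_. 0)"
  proof (rule integral_dominated_convergence[where w="\<lambda>_. 1"])
    show "AE \<omega> in M. (\<lambda>j. T j \<omega>) \<longlonglongrightarrow> 0"
      using K
    proof eventually_elim
      fix \<omega> assume k: "\<forall>j. (\<Sum>i\<in>I j. \<bar>X j i \<omega>\<bar>) \<le> K \<omega>"
      have lim0: "(\<lambda>j. K \<omega> / W j) \<longlonglongrightarrow> 0"
        by (rule real_tendsto_divide_at_top[OF tendsto_const Wlim])
      show "(\<lambda>j. T j \<omega>) \<longlonglongrightarrow> 0"
      proof (rule tendsto_sandwich[OF _ _ tendsto_const lim0])
        show "\<forall>\<^sub>F j in sequentially. T j \<omega> \<le> K \<omega> / W j"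
          using k W0 by (auto simp: T_def intro!: always_eventually min.coboundedI1 divide_right_mono)
      qed (simp add: T0)
    qed
    show "AE \<omega> in M. norm (T j \<omega>) \<le> 1" for j using T0 by simp
  qed (use Tm in auto)
  moreover have "\<forall>\<^sub>F j in sequentially. c0 \<le> expectation (T j)"
    using filterlim_at_top_dense[THEN iffD1, OF Wlim, rule_format, of 0]
  proof eventually_elim
    fix j assume W: "0 < W j"
    have im: "integrable M (\<lambda>\<omega>. min (\<bar>X j i \<omega>\<bar> / \<sigma> j i) 1)" if "i \<in> I j" for i
      using that pos[OF that] by (intro integrable_const_bound[where B=1]) auto
    \<comment> \<open>The weights \<sigma>/W sum to 1 and every normalized variable has the same
      truncated mean \<open>c0\<close>. Concavity appears as two termwise bounds, min t 1 \<le> t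
      and min t 1 \<le> 1.\<close>
    have "c0 = (\<Sum>i\<in>I j. \<sigma> j i / W j * c0)"
      using W by (simp add: W_def flip: sum_divide_distrib sum_distrib_right)
    also have "\<dots> = (\<Sum>i\<in>I j. expectation (\<lambda>\<omega>. \<sigma> j i / W j * min (\<bar>X j i \<omega>\<bar> / \<sigma> j i) 1))"
      by (intro sum.cong refl) (simp only: integral_mult_right_zero mean)
    also have "\<dots> = expectation (\<lambda>\<omega>. \<Sum>i\<in>I j. \<sigma> j i / W j * min (\<bar>X j i \<omega>\<bar> / \<sigma> j i) 1)"
      by (rule Bochner_Integration.integral_sum[symmetric]) (intro integrable_mult_right im)
    also have "\<dots> \<le> expectation (T j)"
    proof (rule integral_mono)
      show "integrable M (\<lambda>\<omega>. \<Sum>i\<in>I j. \<sigma> j i / W j * min (\<bar>X j i \<omega>\<bar> / \<sigma> j i) 1)"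
        by (intro Bochner_Integration.integrable_sum integrable_mult_right im)
      show "integrable M (T j)"
        using T0 Tm by (intro integrable_const_bound[where B=1]) auto
      fix \<omega>
      have "(\<Sum>i\<in>I j. \<sigma> j i / W j * min (\<bar>X j i \<omega>\<bar> / \<sigma> j i) 1) \<le> (\<Sum>i\<in>I j. \<sigma> j i / W j * (\<bar>X j i \<omega>\<bar> / \<sigma> j i))"
        using pos W by (intro sum_mono mult_left_mono) (auto intro: less_imp_le)
      also have "\<dots> = (\<Sum>i\<in>I j. \<bar>X j i \<omega>\<bar>) / W j"
        unfolding sum_divide_distrib using pos by (intro sum.cong refl) (auto dest: pos)
      finally have 1: "(\<Sum>i\<in>I j. \<sigma> j i / W j * min (\<bar>X j i \<omega>\<bar> / \<sigma> j i) 1) \<le> (\<Sum>i\<in>I j. \<bar>X j i \<omega>\<bar>) / W j" .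
      have "(\<Sum>i\<in>I j. \<sigma> j i / W j * min (\<bar>X j i \<omega>\<bar> / \<sigma> j i) 1) \<le> (\<Sum>i\<in>I j. \<sigma> j i / W j * 1)"
        using pos W by (intro sum_mono mult_left_mono) (auto intro: less_imp_le)
      also have "\<dots> = 1" using W by (simp add: W_def flip: sum_divide_distrib)
      finally show "(\<Sum>i\<in>I j. \<sigma> j i / W j * min (\<bar>X j i \<omega>\<bar> / \<sigma> j i) 1) \<le> T j \<omega>"
        using 1 by (simp add: T_def)
    qed
    finally show "c0 \<le> expectation (T j)" .
  qed
  ultimately have "c0 \<le> 0"
    by (intro tendsto_lowerbound[where f="\<lambda>j. expectation (T j)"]) auto
  then show False using c0 by simp
qed

section \<open>Linear relations and marginals of a Brownian bridge\<close>

lemma sum_nth_distinct: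
  assumes "distinct xs"
  shows "(\<Sum>i<length xs. f (xs ! i)) = (\<Sum>x\<in>set xs. f x)"
  by (rule sum.reindex_bij_betw[OF bij_betw_nth]) (use assms in auto)

text \<open>This rewrites the variance prescribed by \<open>brownian_bridge\<close> as the second
  moment of a centered linear combination, which visibly vanishes when the combination is zero
  almost everywhere.\<close>

lemma (in prob_space) quadratic_form_bb_cov:
  assumes f: "\<And>i. i < n \<Longrightarrow> f i \<in> L2_class M"
  shows "(\<Sum>i<n. \<Sum>j<n. c i * c j * bb_cov M (f i) (f j))
    = expectation (\<lambda>x. (\<Sum>i<n. c i * (f i x - expectation (f i)))\<^sup>2)"
proof -
  define d where "d i x = f i x - expectation (f i)" for i x
  have fm: "f i \<in> borel_measurable M" "integrable M (\<lambda>x. (f i x)\<^sup>2)" if "i < n" for i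
    using f[OF that] by (auto simp: L2_class_def)
  have fi: "integrable M (f i)" if "i < n" for i
    using fm[OF that] by (rule square_integrable_imp_integrable)
  have dm[measurable]: "d i \<in> borel_measurable M" if "i < n" for i
    unfolding d_def[abs_def] using fm[OF that] by measurable
  have d2: "integrable M (\<lambda>x. (d i x)\<^sup>2)" if "i < n" for i
    unfolding d_def power2_diff using fm[OF that] fi[OF that] by (intro Bochner_Integration.integrable_add Bochner_Integration.integrable_diff integrable_mult_left integrable_mult_right) auto
  have dd: "integrable M (\<lambda>x. d i x * d j x)" if "i < n" "j < n" for i j
  proof (rule Bochner_Integration.integrable_bound)
    show "integrable M (\<lambda>x. (d i x)\<^sup>2 + (d j x)\<^sup>2)"
      by (intro Bochner_Integration.integrable_add d2 that)
    show "AE x in M. norm (d i x * d j x) \<le> norm ((d i x)\<^sup>2 + (d j x)\<^sup>2)"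
    proof (rule AE_I2)
      fix x
      have "2 * \<bar>d i x * d j x\<bar> \<le> (d i x)\<^sup>2 + (d j x)\<^sup>2"
        using sum_squares_bound[of "\<bar>d i x\<bar>" "\<bar>d j x\<bar>"] by (simp add: abs_mult mult.assoc)
      then have "\<bar>d i x * d j x\<bar> \<le> (d i x)\<^sup>2 + (d j x)\<^sup>2" by linarith
      then show "norm (d i x * d j x) \<le> norm ((d i x)\<^sup>2 + (d j x)\<^sup>2)"
        unfolding real_norm_def by (rule order_trans[OF _ abs_ge_self])
    qed
  qed (use that in measurable)
  have "expectation (\<lambda>x. (\<Sum>i<n. c i * d i x)\<^sup>2) = expectation (\<lambda>x. \<Sum>i<n. \<Sum>j<n. c i * c j * (d i x * d j x))"
    by (simp add: power2_eq_square sum_product ac_simps)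
  also have "\<dots> = (\<Sum>i<n. \<Sum>j<n. c i * c j * expectation (\<lambda>x. d i x * d j x))"
  proof -
    have i: "integrable M (\<lambda>x. c i * c j * (d i x * d j x))" if "i \<in> {..<n}" "j \<in> {..<n}" for i j
      using that by (intro integrable_mult_right dd) auto
    show ?thesis
      by (subst Bochner_Integration.integral_sum, intro Bochner_Integration.integrable_sum i, assumption+,
          rule sum.cong[OF refl], subst Bochner_Integration.integral_sum, rule i, assumption+,
          simp only: integral_mult_right_zero)
  qed
  finally show ?thesis by (simp add: d_def bb_cov_def)
qed

text \<open>The defect of linearity is a Gaussian variable of variance 0.\<close>

lemma brownian_bridge_linear_AE:
  assumes bb: "brownian_bridge P F \<Omega> G" and P: "prob_space P" and F: "F \<subseteq> L2_class P"
    and u: "u \<in> F" and I: "finite I" and w: "\<And>i. i \<in> I \<Longrightarrow> w i \<in> F"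
    and eq: "AE x in P. u x = (\<Sum>i\<in>I. a i * w i x)"
  shows "AE \<omega> in \<Omega>. G u \<omega> = (\<Sum>i\<in>I. a i * G (w i) \<omega>)"
proof -
  interpret P: prob_space P by fact
  obtain xs where xs: "set xs = I" "distinct xs" using finite_distinct_list[OF I] by auto
  \<comment> \<open>The relation is encoded as one combination with coefficient -1 for
    \<open>u\<close>. Repetitions in the list are harmless: the definition of
    \<open>brownian_bridge\<close> quantifies over lists, and only the indices \<open>xs\<close>
    must be distinct.\<close>
  define fs where "fs = u # map w xs"
  define cs where "cs = - 1 # map a xs"
  have split: "(\<Sum>i<length fs. cs ! i * \<phi> (fs ! i)) = (\<Sum>i\<in>I. a i * \<phi> (w i)) - \<phi> u" for \<phi> :: "_ \<Rightarrow> real"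
  proof -
    have "(\<Sum>i<length fs. cs ! i * \<phi> (fs ! i)) = - \<phi> u + (\<Sum>i<length xs. a (xs ! i) * \<phi> (w (xs ! i)))"
      unfolding fs_def cs_def by (simp add: sum.lessThan_Suc_shift del: sum.lessThan_Suc)
    then show ?thesis using sum_nth_distinct[OF xs(2), of "\<lambda>i. a i * \<phi> (w i)"] xs(1) by simp
  qed
  have sub: "set fs \<subseteq> F" using u w xs by (auto simp: fs_def)
  have len: "length cs = length fs" by (simp add: fs_def cs_def)
  have fL: "fs ! i \<in> L2_class P" if "i < length fs" for i
    using that sub F by (meson nth_mem subsetD)
  have int: "integrable P f" if "f \<in> F" for f
    using that F by (auto simp: L2_class_def intro: P.square_integrable_imp_integrable)
  have "(\<Sum>i\<in>I. a i * (\<integral>x. w i x \<partial>P)) = (\<integral>x. (\<Sum>i\<in>I. a i * w i x) \<partial>P)"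
    using int w by (subst Bochner_Integration.integral_sum) auto
  also have "\<dots> = (\<integral>x. u x \<partial>P)"
  proof (rule integral_cong_AE)
    show "AE x in P. (\<Sum>i\<in>I. a i * w i x) = u x" using eq by eventually_elim simp
  qed (use int[OF u] int[OF w] in \<open>auto intro!: borel_measurable_sum\<close>)
  finally have mean: "(\<Sum>i<length fs. cs ! i * (\<integral>x. (fs ! i) x \<partial>P)) = 0"
    using split[of "\<lambda>f. \<integral>x. f x \<partial>P"] by simp
  have "AE x in P. (\<Sum>i<length fs. cs ! i * ((fs ! i) x - (\<integral>x. (fs ! i) x \<partial>P)))\<^sup>2 = 0"
    using eq
  proof eventually_elim
    fix x assume "u x = (\<Sum>i\<in>I. a i * w i x)"
    then have "(\<Sum>i<length fs. cs ! i * (fs ! i) x) = 0" using split[of "\<lambda>f. f x"] by simp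
    then show "(\<Sum>i<length fs. cs ! i * ((fs ! i) x - (\<integral>x. (fs ! i) x \<partial>P)))\<^sup>2 = 0"
      using mean by (simp add: right_diff_distrib sum_subtractf)
  qed
  then have "(\<Sum>i<length fs. \<Sum>j<length fs. cs ! i * cs ! j * bb_cov P (fs ! i) (fs ! j)) = 0"
    by (subst P.quadratic_form_bb_cov[OF fL]) (auto intro: integral_eq_zero_AE)
  moreover have "centered_normal \<Omega> (\<lambda>\<omega>. \<Sum>i<length fs. cs ! i * G (fs ! i) \<omega>)
      (\<Sum>i<length fs. \<Sum>j<length fs. cs ! i * cs ! j * bb_cov P (fs ! i) (fs ! j))"
    using bb[unfolded brownian_bridge_def, THEN conjunct2, THEN conjunct2, THEN conjunct1, rule_format, OF conjI[OF sub len]] .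
  ultimately have "AE \<omega> in \<Omega>. (\<Sum>i<length fs. cs ! i * G (fs ! i) \<omega>) = 0"
    by (simp add: centered_normal_def)
  then show ?thesis
  proof eventually_elim
    fix \<omega> assume "(\<Sum>i<length fs. cs ! i * G (fs ! i) \<omega>) = 0"
    then show "G u \<omega> = (\<Sum>i\<in>I. a i * G (w i) \<omega>)" using split[of "\<lambda>f. G f \<omega>"] by simp
  qed
qed

lemma brownian_bridge_normal:
  assumes bb: "brownian_bridge P F \<Omega> G" and w: "w \<in> F" and v: "0 < bb_cov P w w"
  shows "distributed \<Omega> lborel (G w) (normal_density 0 (sqrt (bb_cov P w w)))"
proof -
  have "set [w] \<subseteq> F \<and> length [1::real] = length [w]" using w by simp
  then have "centered_normal \<Omega> (\<lambda>\<omega>. \<Sum>i<length [w]. [1] ! i * G ([w] ! i) \<omega>)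
          (\<Sum>i<length [w]. \<Sum>j<length [w]. [1] ! i * [1] ! j * bb_cov P ([w] ! i) ([w] ! j))"
    by (rule bb[unfolded brownian_bridge_def, THEN conjunct2, THEN conjunct2, THEN conjunct1, rule_format])
  then show ?thesis using v by (simp add: centered_normal_def)
qed

section \<open>Variance of the lattice atoms\<close>

text \<open>The law is a density over the completed measure, whereas the product formulas concern
  \<open>lborel\<close>; this passes from one to the other.\<close>

lemma integral_density_lebesgue:
  fixes f :: "'a::euclidean_space \<Rightarrow> real"
  assumes "dens \<in> borel_measurable borel" "\<And>x. 0 \<le> dens x" "f \<in> borel_measurable borel"
  shows "(\<integral>x. f x \<partial>density lebesgue (\<lambda>x. ennreal (dens x))) = (LINT x|lborel. dens x * f x)"
proof -
  have "(\<integral>x. f x \<partial>density lebesgue (\<lambda>x. ennreal (dens x))) = (\<integral>x. dens x * f x \<partial>lebesgue)"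
    using assms by (subst integral_density) (auto intro: measurable_completion)
  also have "\<dots> = (LINT x|lborel. dens x * f x)"
    using assms by (intro integral_completion) auto
  finally show ?thesis .
qed

lemma integral_real_affine:
  fixes \<phi> :: "real \<Rightarrow> real"
  assumes "0 < R"
  shows "(LINT t|lborel. \<phi> (R * t + a)) = (LINT t|lborel. \<phi> t) / R"
  using assms by (subst (2) lborel_integral_real_affine[where c=R and t=a]) (auto simp: add.commute)

lemma integrable_real_affine:
  fixes \<phi> :: "real \<Rightarrow> real"
  assumes "0 < R" "integrable lborel \<phi>"
  shows "integrable lborel (\<lambda>t. \<phi> (R * t + a))"
  using lborel_integrable_real_affine[of \<phi> R a] assms by (simp add: add.commute)

lemma borel_measurable_lattice_atom:
  assumes [measurable]: "g \<in> borel_measurable borel"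
  shows "lattice_atom g R x0 n \<in> borel_measurable borel"
  unfolding lattice_atom_def[abs_def] by measurable

text \<open>Variance is second moment minus squared mean. The second moment is restricted to the
  cell on which all arguments of \<open>g\<close> lie in [-1,1], where \<open>near\<close> bounds
  the density below; the mean is at most \<open>D\<close> times the L1 norm. The subtracted term is
  quadratic in R^(-d), the main term linear.\<close>

lemma bb_cov_lattice_atom_ge:
  fixes x0 :: "'a::euclidean_space" and g :: "real \<Rightarrow> real" and a c C D R \<kappa> :: real
  assumes dm: "dens \<in> borel_measurable borel" and d0: "\<And>x. 0 \<le> dens x" and dD: "\<And>x. dens x \<le> D"
    and P: "prob_space (density lebesgue (\<lambda>x. ennreal (dens x)))"
    and gm: "g \<in> borel_measurable borel" and C: "0 \<le> C" and gC: "\<And>t. \<bar>g t\<bar> \<le> C / (1 + t\<^sup>2)"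
    and R: "0 < R" and c: "0 \<le> c" and near: "\<And>x. norm (x - x0) \<le> \<kappa> * DIM('a) \<Longrightarrow> c \<le> dens x"
    and M: "real M \<le> \<kappa> * R" and n: "n \<in> lattice_box M"
  shows "a\<^sup>2 * (c * ((LINT t|lborel. indicat_real {-1..1} t * (g t)\<^sup>2) / R) ^ DIM('a)
        - (D * ((LINT t|lborel. \<bar>g t\<bar>) / R) ^ DIM('a))\<^sup>2)
    \<le> bb_cov (density lebesgue (\<lambda>x. ennreal (dens x)))
        (\<lambda>x. a * lattice_atom g R x0 n x) (\<lambda>x. a * lattice_atom g R x0 n x)"
proof -
  let ?P = "density lebesgue (\<lambda>x. ennreal (dens x))"
  interpret P: prob_space ?P by fact
  define A where "A = lattice_atom g R x0 n"
  define y where "y b = - (R * (x0 \<bullet> b)) - real (n b)" for b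
  define \<phi> where "\<phi> t = indicat_real {-1..1} t * (g t)\<^sup>2" for t
  note [measurable] = gm dm
  have Adef: "A x = (\<Prod>b\<in>Basis. g (R * (x \<bullet> b) + y b))" for x
    by (simp add: A_def lattice_atom_def y_def)
  have Am[measurable]: "A \<in> borel_measurable borel" unfolding A_def by (rule borel_measurable_lattice_atom[OF gm])
  have AmP: "A \<in> borel_measurable ?P" "(\<lambda>x. (A x)\<^sup>2) \<in> borel_measurable ?P"
    by (auto intro!: measurable_completion)
  have gi: "integrable lborel g" by (rule integrable_inverse_square_decay[OF gm gC])
  have gC': "\<bar>g t\<bar> \<le> C" for t
  proof -
    have "C / (1 + t\<^sup>2) \<le> C / 1" using C by (intro divide_left_mono) (auto simp: add_pos_nonneg)
    then show ?thesis using gC[of t] by simp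
  qed
  have Abd: "\<bar>A x\<bar> \<le> C ^ DIM('a)" for x
  proof -
    have "\<bar>A x\<bar> \<le> (\<Prod>b\<in>(Basis::'a set). C)"
      unfolding Adef abs_prod by (intro prod_mono) (auto intro: gC')
    then show ?thesis by simp
  qed
  have A2bd: "(A x)\<^sup>2 \<le> C ^ DIM('a) * \<bar>A x\<bar>" for x
  proof -
    have "(A x)\<^sup>2 = \<bar>A x\<bar> * \<bar>A x\<bar>" by (simp add: power2_eq_square)
    also have "\<dots> \<le> C ^ DIM('a) * \<bar>A x\<bar>" by (intro mult_right_mono Abd) auto
    finally show ?thesis .
  qed
  have Ai: "integrable lborel A"
    unfolding Adef[abs_def] by (rule lborel_integral_prod) (rule integrable_real_affine[OF R gi])
  have D: "0 \<le> D" using d0 dD order_trans by blast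
  have PA: "integrable ?P A"
    by (rule P.integrable_const_bound[where B="C ^ DIM('a)"]) (use Abd AmP in auto)
  have PA2: "integrable ?P (\<lambda>x. (A x)\<^sup>2)"
  proof (rule P.integrable_const_bound[where B="C ^ DIM('a) * C ^ DIM('a)"])
    show "AE x in ?P. norm ((A x)\<^sup>2) \<le> C ^ DIM('a) * C ^ DIM('a)"
    proof (rule AE_I2)
      fix x
      have "C ^ DIM('a) * \<bar>A x\<bar> \<le> C ^ DIM('a) * C ^ DIM('a)"
        using C by (intro mult_left_mono Abd) auto
      then show "norm ((A x)\<^sup>2) \<le> C ^ DIM('a) * C ^ DIM('a)" using A2bd[of x] by simp
    qed
  qed (rule AmP)
  have mean: "\<bar>P.expectation A\<bar> \<le> D * ((LINT t|lborel. \<bar>g t\<bar>) / R) ^ DIM('a)"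
  proof -
    have "\<bar>P.expectation A\<bar> = \<bar>LINT x|lborel. dens x * A x\<bar>"
      using integral_density_lebesgue[OF dm d0 Am] by simp
    also have "\<dots> \<le> (LINT x|lborel. \<bar>dens x * A x\<bar>)" by (rule integral_abs_bound)
    also have "\<dots> \<le> (LINT x|lborel. D * \<bar>A x\<bar>)"
    proof (rule integral_mono)
      have le: "\<bar>dens x * A x\<bar> \<le> D * \<bar>A x\<bar>" for x
        unfolding abs_mult using d0[of x] dD[of x] by (intro mult_right_mono) auto
      show "\<bar>dens x * A x\<bar> \<le> D * \<bar>A x\<bar>" for x by (rule le)
      show i: "integrable lborel (\<lambda>x. D * \<bar>A x\<bar>)" using Ai by auto
      show "integrable lborel (\<lambda>x. \<bar>dens x * A x\<bar>)"
        by (rule Bochner_Integration.integrable_bound[OF i]) (use le in \<open>auto intro!: AE_I2 order_trans[OF _ abs_ge_self]\<close>)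
    qed
    also have "\<dots> = D * ((LINT t|lborel. \<bar>g t\<bar>) / R) ^ DIM('a)"
      unfolding integral_mult_right_zero A_def by (simp only: integral_abs_lattice_atom[OF gi R])
    finally show ?thesis .
  qed
  have \<phi>i: "integrable lborel \<phi>"
  proof (rule Bochner_Integration.integrable_bound)
    show "integrable lborel (\<lambda>t. C * \<bar>g t\<bar>)" using gi by auto
    show "\<phi> \<in> borel_measurable lborel" unfolding \<phi>_def[abs_def] by measurable
    show "AE t in lborel. norm (\<phi> t) \<le> norm (C * \<bar>g t\<bar>)"
    proof (rule AE_I2)
      fix t
      have "norm (\<phi> t) \<le> (g t)\<^sup>2" by (auto simp: \<phi>_def indicator_def)
      also have "(g t)\<^sup>2 = \<bar>g t\<bar> * \<bar>g t\<bar>" by (simp add: power2_eq_square)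
      also have "\<dots> \<le> C * \<bar>g t\<bar>" by (intro mult_right_mono gC') auto
      also have "\<dots> \<le> norm (C * \<bar>g t\<bar>)" unfolding real_norm_def by (rule abs_ge_self)
      finally show "norm (\<phi> t) \<le> norm (C * \<bar>g t\<bar>)" .
    qed
  qed
  have second: "c * ((LINT t|lborel. \<phi> t) / R) ^ DIM('a) \<le> P.expectation (\<lambda>x. (A x)\<^sup>2)"
  proof -
    have "c * ((LINT t|lborel. \<phi> t) / R) ^ DIM('a) = c * (\<Prod>b\<in>(Basis::'a set). LINT t|lborel. \<phi> (R * t + y b))"
      by (simp add: integral_real_affine[OF R])
    also have "\<dots> = (LINT x|lborel. c * (\<Prod>b\<in>Basis. \<phi> (R * ((x::'a) \<bullet> b) + y b)))"
      unfolding integral_mult_right_zero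
      by (subst lborel_integral_prod(2)[where f="\<lambda>b t. \<phi> (R * t + y b)"]) (auto intro: integrable_real_affine[OF R \<phi>i])
    also have "\<dots> \<le> (LINT x|lborel. dens x * (A x)\<^sup>2)"
    proof (rule integral_mono)
      show "integrable lborel (\<lambda>x::'a. c * (\<Prod>b\<in>Basis. \<phi> (R * (x \<bullet> b) + y b)))"
        by (intro integrable_mult_right lborel_integral_prod(1)[where f="\<lambda>b t. \<phi> (R * t + y b)"] integrable_real_affine[OF R \<phi>i])
      show "integrable lborel (\<lambda>x. dens x * (A x)\<^sup>2)"
      proof (rule Bochner_Integration.integrable_bound)
        show "integrable lborel (\<lambda>x. D * (C ^ DIM('a) * \<bar>A x\<bar>))" using Ai by auto
        show "AE x in lborel. norm (dens x * (A x)\<^sup>2) \<le> norm (D * (C ^ DIM('a) * \<bar>A x\<bar>))"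
        proof (rule AE_I2)
          fix x
          have "norm (dens x * (A x)\<^sup>2) = dens x * (A x)\<^sup>2" using d0[of x] by simp
          also have "\<dots> \<le> D * (C ^ DIM('a) * \<bar>A x\<bar>)" using dD D A2bd by (intro mult_mono) auto
          also have "\<dots> \<le> norm (D * (C ^ DIM('a) * \<bar>A x\<bar>))" unfolding real_norm_def by (rule abs_ge_self)
          finally show "norm (dens x * (A x)\<^sup>2) \<le> norm (D * (C ^ DIM('a) * \<bar>A x\<bar>))" .
        qed
      qed simp
      fix x :: 'a
      show "c * (\<Prod>b\<in>Basis. \<phi> (R * (x \<bullet> b) + y b)) \<le> dens x * (A x)\<^sup>2"
      proof (cases "\<forall>b\<in>Basis. \<bar>R * (x \<bullet> b) + y b\<bar> \<le> 1")
        case True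
        have "\<bar>(x - x0) \<bullet> b\<bar> \<le> \<kappa>" if b: "b \<in> Basis" for b
        proof -
          \<comment> \<open>Strictness matters: n b + 1 \<le> M absorbs the half-width 1 of the
            cell, so each coordinate of x - x0 is at most M/R \<le> \<kappa> in modulus.\<close>
          have "n b < M" using n b by (auto simp: lattice_box_def PiE_iff)
          moreover have "\<bar>R * ((x - x0) \<bullet> b)\<bar> \<le> real (n b) + 1"
            using True[rule_format, OF b] by (simp add: y_def inner_diff_left right_diff_distrib)
          ultimately have "\<bar>R * ((x - x0) \<bullet> b)\<bar> \<le> \<kappa> * R" using M by linarith
          then have "R * \<bar>(x - x0) \<bullet> b\<bar> \<le> R * \<kappa>"
            using R by (simp add: abs_mult mult.commute)
          then show ?thesis using R by simp
        qed
        then have "norm (x - x0) \<le> \<kappa> * DIM('a)"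
          using norm_le_l1[of "x - x0"] sum_bounded_above[of Basis "\<lambda>b. \<bar>(x - x0) \<bullet> b\<bar>" \<kappa>] by (simp add: mult.commute)
        then have "c \<le> dens x" by (rule near)
        moreover have "(\<Prod>b\<in>Basis. \<phi> (R * (x \<bullet> b) + y b)) = (A x)\<^sup>2"
          unfolding Adef prod_power_distrib using True by (intro prod.cong refl) (auto simp: \<phi>_def indicator_def abs_le_iff)
        ultimately show ?thesis by (simp add: mult_right_mono)
      next
        case False
        then obtain b where "b \<in> Basis" "\<phi> (R * (x \<bullet> b) + y b) = 0"
          by (auto simp: \<phi>_def indicator_def abs_le_iff)
        then have "(\<Prod>b\<in>Basis. \<phi> (R * (x \<bullet> b) + y b)) = 0"
          by (subst prod_zero_iff) auto
        then show ?thesis using d0[of x] by (simp only: mult_zero_right zero_le_mult_iff zero_le_power2 simp_thms)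
      qed
    qed
    also have "\<dots> = P.expectation (\<lambda>x. (A x)\<^sup>2)"
      by (rule integral_density_lebesgue[OF dm d0, symmetric]) simp
    finally show ?thesis .
  qed
  have "(P.expectation A)\<^sup>2 \<le> (D * ((LINT t|lborel. \<bar>g t\<bar>) / R) ^ DIM('a))\<^sup>2"
    using mean by (metis abs_ge_zero power2_abs power_mono)
  then have "a\<^sup>2 * (c * ((LINT t|lborel. \<phi> t) / R) ^ DIM('a) - (D * ((LINT t|lborel. \<bar>g t\<bar>) / R) ^ DIM('a))\<^sup>2)
    \<le> a\<^sup>2 * (P.expectation (\<lambda>x. (A x)\<^sup>2) - (P.expectation A)\<^sup>2)"
    using second by (intro mult_left_mono) auto
  also have "\<dots> = a\<^sup>2 * P.variance A" by (simp only: P.variance_eq[OF PA PA2])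
  also have "\<dots> = bb_cov ?P (\<lambda>x. a * A x) (\<lambda>x. a * A x)"
  proof -
    have "(a * A x - a * e) * (a * A x - a * e) = a\<^sup>2 * (A x - e)\<^sup>2" for x e
      by (simp add: power2_eq_square algebra_simps)
    then show ?thesis unfolding bb_cov_def integral_mult_right_zero by simp
  qed
  finally show ?thesis by (simp only: A_def \<phi>_def)
qed

text \<open>This lets the explicit atom replace its arbitrarily selected representative in the
  covariance.\<close>

lemma bb_cov_cong_AE:
  assumes "u \<in> borel_measurable P" "v \<in> borel_measurable P" "AE x in P. u x = v x"
  shows "bb_cov P u u = bb_cov P v v"
proof -
  have e: "(\<integral>x. u x \<partial>P) = (\<integral>x. v x \<partial>P)" using assms by (rule integral_cong_AE)
  show ?thesis unfolding bb_cov_def e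
    using assms(1,2) by (intro integral_cong_AE) (use assms(3) in \<open>auto elim: eventually_mono\<close>)
qed

section \<open>Unboundedness of the Brownian bridge\<close>

text \<open>The last property is the mass of the window on its own cell; its d-th power becomes the
  constant in the lower bound for the variances.\<close>

lemma band_limited_fourier_pair_exists:
  fixes \<delta> \<omega> :: real
  assumes "0 < \<delta>" "0 < \<omega>"
  obtains g :: "real \<Rightarrow> real" and h :: "real \<Rightarrow> complex" and C :: real where
    "0 \<le> C" "g \<in> borel_measurable borel" "\<And>t. \<bar>g t\<bar> \<le> C / (1 + t\<^sup>2)" "fourier_pair g h"
    "\<And>\<tau>. h \<tau> \<noteq> 0 \<Longrightarrow> \<omega> - \<delta> \<le> \<bar>\<tau>\<bar> \<and> \<bar>\<tau>\<bar> \<le> \<omega> + \<delta>"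
    "0 < (LINT t|lborel. indicat_real {-1..1} t * (g t)\<^sup>2)"
proof -
  obtain g h :: "real \<Rightarrow> real" and C r :: real where
    C: "0 < C" and gm[measurable]: "g \<in> borel_measurable borel" and gC: "\<And>t. \<bar>g t\<bar> \<le> C / (1 + t\<^sup>2)"
    and hc: "continuous_on UNIV h" and hb: "\<And>\<tau>. \<bar>h \<tau>\<bar> \<le> 1" and hi: "integrable lborel h"
    and supp: "\<And>\<tau>. \<delta> < \<bar>\<bar>\<tau>\<bar> - \<omega>\<bar> \<Longrightarrow> h \<tau> = 0"
    and FT: "\<And>\<tau>. (LINT t|lborel. complex_of_real (g t) * cis (- (t * \<tau>))) = of_real (h \<tau>)"
    and IFT: "\<And>t. (LINT \<tau>|lborel. complex_of_real (h \<tau>) * cis (t * \<tau>)) = of_real (2 * pi * g t)"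
    and r: "0 < r" and nz: "\<And>t. 0 < t \<Longrightarrow> t < r \<Longrightarrow> g t \<noteq> 0"
    by (rule band_limited_function_exists[OF assms]) blast
  have gi: "integrable lborel g" by (rule integrable_inverse_square_decay[OF gm gC])
  have pair: "fourier_pair g (\<lambda>\<tau>. complex_of_real (h \<tau>))"
    unfolding fourier_pair_def using gi hi FT IFT by simp
  have supp': "\<omega> - \<delta> \<le> \<bar>\<tau>\<bar> \<and> \<bar>\<tau>\<bar> \<le> \<omega> + \<delta>" if "complex_of_real (h \<tau>) \<noteq> 0" for \<tau>
  proof -
    have "\<not> \<delta> < \<bar>\<bar>\<tau>\<bar> - \<omega>\<bar>" using that supp[of \<tau>] by auto
    then show ?thesis by linarith
  qed
  let ?\<phi> = "\<lambda>t. indicat_real {-1..1} t * (g t)\<^sup>2"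
  have int: "integrable lborel ?\<phi>"
  proof (rule Bochner_Integration.integrable_bound)
    show "integrable lborel (\<lambda>t. C * \<bar>g t\<bar>)" using gi by auto
    show "AE t in lborel. norm (?\<phi> t) \<le> norm (C * \<bar>g t\<bar>)"
    proof (rule AE_I2)
      fix t
      have "C / (1 + t\<^sup>2) \<le> C / 1" using C by (intro divide_left_mono) (auto simp: add_pos_nonneg)
      then have "\<bar>g t\<bar> * \<bar>g t\<bar> \<le> C * \<bar>g t\<bar>" using gC[of t] by (intro mult_right_mono) auto
      moreover have "norm (?\<phi> t) \<le> \<bar>g t\<bar> * \<bar>g t\<bar>" by (auto simp: indicator_def power2_eq_square)
      ultimately show "norm (?\<phi> t) \<le> norm (C * \<bar>g t\<bar>)" by simp
    qed
  qed simp
  have "(LINT t|lborel. ?\<phi> t) \<noteq> 0"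
  proof
    define m where "m = min r 1"
    have m: "0 < m" using r by (simp add: m_def)
    assume "(LINT t|lborel. ?\<phi> t) = 0"
    then have "AE t in lborel. ?\<phi> t = 0"
      by (subst (asm) integral_nonneg_eq_0_iff_AE[OF int]) auto
    then have "AE t in lborel. t \<notin> {0<..<m}"
      by eventually_elim (use nz in \<open>auto simp: m_def indicator_def split: if_splits\<close>)
    then have "{0<..<m} \<in> null_sets lborel" by (subst AE_iff_null_sets) auto
    then have "emeasure lborel {0<..<m} = 0" by auto
    then show False using m by simp
  qed
  moreover have "0 \<le> (LINT t|lborel. ?\<phi> t)" by (intro Bochner_Integration.integral_nonneg) auto
  ultimately have "0 < (LINT t|lborel. ?\<phi> t)" by linarith
  from that[OF less_imp_le[OF C] gm gC pair supp' this] show thesis .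
qed

lemma filterlim_two_powr_at_top:
  fixes e K :: real
  assumes "0 < e" "0 < K"
  shows "filterlim (\<lambda>j. K * 2 powr (real j * e)) at_top sequentially"
proof -
  have "filterlim (\<lambda>j. real j * (e * ln 2)) at_top sequentially"
    using assms by (intro filterlim_at_top_mult_tendsto_pos[OF tendsto_const] filterlim_real_sequentially) auto
  then have "filterlim (\<lambda>j. exp (real j * (e * ln 2))) at_top sequentially"
    by (rule filterlim_compose[OF exp_at_top])
  then have "filterlim (\<lambda>j. 2 powr (real j * e)) at_top sequentially"
    by (simp add: powr_def mult.assoc)
  then show ?thesis
    using assms by (intro filterlim_tendsto_pos_mult_at_top[OF tendsto_const])
qed

lemma besov_unit_ball_not_pregaussian:
  fixes phi0 :: "'a::euclidean_space \<Rightarrow> real" and s c :: real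
  assumes smooth: "C_infinity phi0"
    and one: "\<forall>x. norm x \<le> 1 \<longrightarrow> phi0 x = 1"
    and zero: "\<forall>x. norm x \<ge> 3/2 \<longrightarrow> phi0 x = 0"
    and p: "1 \<le> p" and q: "1 \<le> q"
    and s: "s < DIM('a) / 2"
    and rep: "\<forall>f\<in>besov_unit_ball phi0 s p q. \<exists>u\<in>\<U>. AE x in lebesgue. u x = f x"
    and dm: "dens \<in> borel_measurable borel" and d0: "\<forall>x. 0 \<le> dens x" and db: "bounded (range dens)"
    and P: "prob_space (density lebesgue (\<lambda>x. ennreal (dens x)))"
    and c: "0 < c" and V: "open V" "V \<noteq> {}" "\<forall>x\<in>V. c \<le> dens x"
  shows "\<not> pregaussian TYPE('w) (density lebesgue (\<lambda>x. ennreal (dens x))) \<U>"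
proof
  let ?P = "density lebesgue (\<lambda>x. ennreal (dens x))" and ?d = "DIM('a)"
  assume pre: "pregaussian TYPE('w) ?P \<U>"
  then have F: "\<U> \<subseteq> L2_class ?P" by (simp add: pregaussian_def)
  from pre obtain \<Omega> :: "'w measure" and G where bb: "brownian_bridge ?P \<U> \<Omega> G"
    and bd: "\<And>\<omega>. \<omega> \<in> space \<Omega> \<Longrightarrow> bounded ((\<lambda>f. G f \<omega>) ` \<U>)"
    unfolding pregaussian_def by blast
  interpret P: prob_space ?P by fact
  interpret \<Omega>: prob_space \<Omega> using bb by (simp add: brownian_bridge_def)
  \<comment> \<open>Lebesgue null sets are null for the law, so relations between functions survive
    the passage to representatives.\<close>
  have AE_P: "AE x in ?P. Q x" if "AE x in lebesgue. Q x" for Q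
    using dm that by (subst AE_density) (auto elim: eventually_mono intro: measurable_completion)

  obtain K where K: "\<And>\<omega> f. \<omega> \<in> space \<Omega> \<Longrightarrow> f \<in> \<U> \<Longrightarrow> \<bar>G f \<omega>\<bar> \<le> K \<omega>"
  proof -
    have "\<forall>\<omega>\<in>space \<Omega>. \<exists>k. \<forall>f\<in>\<U>. \<bar>G f \<omega>\<bar> \<le> k"
      using bd by (auto simp: bounded_iff)
    then show thesis using that by (metis bchoice)
  qed
  obtain D where D: "\<And>x. dens x \<le> D"
    using db d0 by (auto simp: bounded_iff)
  obtain x0 \<rho> where \<rho>: "0 < \<rho>" "cball x0 \<rho> \<subseteq> V"
    using V(1,2) open_contains_cball by blast
  \<comment> \<open>The division by d converts a coordinatewise bound \<kappa> into a Euclidean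
    bound \<rho> through the l1 norm.\<close>
  define \<kappa> where "\<kappa> = \<rho> / ?d"
  have \<kappa>: "0 < \<kappa>" using \<rho> by (simp add: \<kappa>_def)
  have near: "c \<le> dens x" if "norm (x - x0) \<le> \<kappa> * ?d" for x
  proof -
    have "x \<in> cball x0 \<rho>" using that by (simp add: \<kappa>_def dist_norm norm_minus_commute)
    then show ?thesis using V(3) \<rho>(2) by blast
  qed
  have sd: "0 < sqrt (real ?d)" by simp
  \<comment> \<open>Center 7/4 and half-width 1/4 fill exactly [3/2, 2]; dividing by sqrt d
    compensates the factor that the norm gains from d coordinates.\<close>
  obtain g :: "real \<Rightarrow> real" and h :: "real \<Rightarrow> complex" and C :: real where
    C: "0 \<le> C" and gm: "g \<in> borel_measurable borel" and gC: "\<And>t. \<bar>g t\<bar> \<le> C / (1 + t\<^sup>2)"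
    and gh: "fourier_pair g h"
    and supp: "\<And>\<tau>. h \<tau> \<noteq> 0 \<Longrightarrow> 7/4 / sqrt ?d - 1/4 / sqrt ?d \<le> \<bar>\<tau>\<bar> \<and> \<bar>\<tau>\<bar> \<le> 7/4 / sqrt ?d + 1/4 / sqrt ?d"
    and I1: "0 < (LINT t|lborel. indicat_real {-1..1} t * (g t)\<^sup>2)"
    by (rule band_limited_fourier_pair_exists[of "1/4 / sqrt ?d" "7/4 / sqrt ?d"]) (use sd in auto)
  have supp': "3/2 / sqrt ?d \<le> \<bar>\<tau>\<bar> \<and> \<bar>\<tau>\<bar> \<le> 2 / sqrt ?d" if "h \<tau> \<noteq> 0" for \<tau>
    using supp[OF that] by (simp flip: add_divide_distrib diff_divide_distrib)
  obtain B where B: "0 < B" and ball: "\<And>j M x0 \<epsilon>. real M \<le> \<kappa> * 2 ^ j \<Longrightarrow> (\<And>n. \<bar>\<epsilon> n\<bar> \<le> 1) \<Longrightarrow>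
      (\<lambda>x. \<Sum>n\<in>lattice_box M. (2 powr - (real (Suc j) * s) / B * \<epsilon> n) * lattice_atom g (2 ^ j) x0 n x)
      \<in> besov_unit_ball phi0 s p q"
  proof (rule lattice_sums_in_besov_unit_ball[where s=s, OF C_infinity_continuous[OF smooth] one zero p q C gC gh supp' less_imp_le[OF \<kappa>]])
    fix B assume "0 < B" and b: "\<And>j M x0 \<epsilon>. real M \<le> \<kappa> * 2 ^ j \<Longrightarrow> (\<And>n. \<bar>\<epsilon> n\<bar> \<le> 1) \<Longrightarrow>
      (\<lambda>x. \<Sum>n\<in>lattice_box M. (2 powr - (real (Suc j) * s) / B * \<epsilon> n) * lattice_atom g (2 ^ j) x0 n x)
      \<in> besov_unit_ball phi0 s p q"
    then show thesis by (rule that)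
  qed

  define M where "M j = nat \<lfloor>\<kappa> * 2 ^ j\<rfloor>" for j :: nat
  define a where "a j = 2 powr - (real (Suc j) * s) / B" for j
  define A where "A j = lattice_atom g (2 ^ j) x0" for j :: nat
  define f where "f j \<epsilon> x = (\<Sum>n\<in>lattice_box (M j). (a j * \<epsilon> n) * A j n x)" for j \<epsilon> x
  have M: "real (M j) \<le> \<kappa> * 2 ^ j" "\<kappa> * 2 ^ j - 1 \<le> real (M j)" for j
    using \<kappa> by (auto simp: M_def)
  have a: "0 < a j" for j using B by (simp add: a_def)
  have fb: "f j \<epsilon> \<in> besov_unit_ball phi0 s p q" if "\<And>n. \<bar>\<epsilon> n\<bar> \<le> 1" for j \<epsilon>
    unfolding f_def[abs_def] a_def A_def by (rule ball[OF M(1) that])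
  obtain R where R: "\<And>f. f \<in> besov_unit_ball phi0 s p q \<Longrightarrow> R f \<in> \<U> \<and> (AE x in lebesgue. R f x = f x)"
    using rep by metis
  \<comment> \<open>A single atom is the lattice sum with coefficient 1 at \<open>n\<close> and 0
    elsewhere. It thus carries the same factor \<open>a j\<close> as the signed sums, which become
    exact \<plusminus>1 combinations of the \<open>w j n\<close> almost everywhere.\<close>
  define w where "w j n = R (f j (\<lambda>m. if m = n then 1 else 0))" for j n
  define \<epsilon> where "\<epsilon> S n = (if n \<in> S then 1 else - 1 :: real)" for S and n :: "'a \<Rightarrow> nat"
  define u where "u j S = R (f j (\<epsilon> S))" for j S
  have wU: "w j n \<in> \<U>" for j n unfolding w_def using R[OF fb] by auto
  have uU: "u j S \<in> \<U>" for j S unfolding u_def using R[OF fb] by (auto simp: \<epsilon>_def)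
  have w_eq: "AE x in lebesgue. w j n x = a j * A j n x" if "n \<in> lattice_box (M j)" for j n
  proof -
    have "f j (\<lambda>m. if m = n then 1 else 0) x = a j * A j n x" for x
      using that by (simp add: f_def if_distrib[of "\<lambda>t. _ * t"] if_distrib[of "\<lambda>t. t * _"] cong: if_cong)
    moreover have "AE x in lebesgue. w j n x = f j (\<lambda>m. if m = n then 1 else 0) x"
      unfolding w_def using R[OF fb] by auto
    ultimately show ?thesis by simp
  qed
  have u_eq: "AE x in lebesgue. u j S x = f j (\<epsilon> S) x" for j S
    unfolding u_def using R[OF fb, of "\<epsilon> S"] by (auto simp: \<epsilon>_def)

  have lin: "AE \<omega> in \<Omega>. G (u j S) \<omega> = (\<Sum>n\<in>lattice_box (M j). \<epsilon> S n * G (w j n) \<omega>)" for j S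
  proof (rule brownian_bridge_linear_AE[OF bb P F uU finite_lattice_box wU])
    have "AE x in lebesgue. \<forall>n\<in>lattice_box (M j). w j n x = a j * A j n x"
      by (rule AE_finite_allI[OF finite_lattice_box w_eq])
    then have "AE x in lebesgue. u j S x = (\<Sum>n\<in>lattice_box (M j). \<epsilon> S n * w j n x)"
      using u_eq[of j S] by eventually_elim (auto simp: f_def intro!: sum.cong)
    then show "AE x in ?P. u j S x = (\<Sum>n\<in>lattice_box (M j). \<epsilon> S n * w j n x)" by (rule AE_P)
  qed
  have dom: "AE \<omega> in \<Omega>. \<forall>j. (\<Sum>n\<in>lattice_box (M j). \<bar>G (w j n) \<omega>\<bar>) \<le> K \<omega>"
  proof (subst AE_all_countable, rule allI)
    fix j
    \<comment> \<open>The set of indices taken with sign +1 depends on \<omega>, so linearity must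
      hold simultaneously for all \<open>S\<close>: finitely many for each j, and countably many j
      in total.\<close>
    have "AE \<omega> in \<Omega>. \<forall>S\<in>Pow (lattice_box (M j)). G (u j S) \<omega> = (\<Sum>n\<in>lattice_box (M j). \<epsilon> S n * G (w j n) \<omega>)"
      by (rule AE_finite_allI[OF _ lin]) simp
    then show "AE \<omega> in \<Omega>. (\<Sum>n\<in>lattice_box (M j). \<bar>G (w j n) \<omega>\<bar>) \<le> K \<omega>"
      using AE_space
    proof eventually_elim
      fix \<omega> assume *: "\<forall>S\<in>Pow (lattice_box (M j)). G (u j S) \<omega> = (\<Sum>n\<in>lattice_box (M j). \<epsilon> S n * G (w j n) \<omega>)"
        and \<omega>: "\<omega> \<in> space \<Omega>"
      define S where "S = {n \<in> lattice_box (M j). 0 \<le> G (w j n) \<omega>}"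
      have "(\<Sum>n\<in>lattice_box (M j). \<bar>G (w j n) \<omega>\<bar>) = (\<Sum>n\<in>lattice_box (M j). \<epsilon> S n * G (w j n) \<omega>)"
        by (intro sum.cong refl) (auto simp: \<epsilon>_def S_def)
      also have "\<dots> = G (u j S) \<omega>" using * by (auto simp: S_def)
      also have "\<dots> \<le> K \<omega>" using K[OF \<omega> uU[of j S]] by linarith
      finally show "(\<Sum>n\<in>lattice_box (M j). \<bar>G (w j n) \<omega>\<bar>) \<le> K \<omega>" .
    qed
  qed

  define I where "I = (LINT t|lborel. indicat_real {-1..1} t * (g t)\<^sup>2)"
  define L where "L = (LINT t|lborel. \<bar>g t\<bar>)"
  \<comment> \<open>Half of the main term is kept; the other half absorbs the squared mean once j is
    large.\<close>
  define v0 where "v0 = c * I ^ ?d / 2"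
  have v0: "0 < v0" using I1 c by (simp add: v0_def I_def)
  have var: "(a j)\<^sup>2 * (c * (I / 2 ^ j) ^ ?d - (D * (L / 2 ^ j) ^ ?d)\<^sup>2) \<le> bb_cov ?P (w j n) (w j n)"
    if n: "n \<in> lattice_box (M j)" for j n
  proof -
    have "A j n \<in> borel_measurable borel" unfolding A_def by (rule borel_measurable_lattice_atom[OF gm])
    then have m: "(\<lambda>x. a j * A j n x) \<in> borel_measurable ?P" by (auto intro!: measurable_completion)
    have "bb_cov ?P (w j n) (w j n) = bb_cov ?P (\<lambda>x. a j * A j n x) (\<lambda>x. a j * A j n x)"
      by (rule bb_cov_cong_AE[OF _ m AE_P[OF w_eq[OF n]]]) (use F wU in \<open>auto simp: L2_class_def\<close>)
    then show ?thesis
      unfolding A_def I_def L_def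
      using bb_cov_lattice_atom_ge[where a="a j", OF dm _ D P gm C gC _ less_imp_le[OF c] near M(1) n] d0 by simp
  qed
  have R0: "(\<lambda>j. (1 / 2 ^ j) ^ ?d :: real) \<longlonglongrightarrow> 0"
  proof -
    have "(\<lambda>j. (1 / 2 ^ j) :: real) \<longlonglongrightarrow> 0"
      using LIMSEQ_power_zero[of "1/2::real"] by (simp add: power_divide)
    then have "(\<lambda>j. (1 / 2 ^ j) ^ ?d :: real) \<longlonglongrightarrow> 0 ^ ?d" by (rule tendsto_power)
    moreover have "(0 :: real) ^ ?d = 0" by simp
    ultimately show ?thesis by (simp only:)
  qed
  have "\<forall>\<^sub>F j in sequentially. (D * L ^ ?d)\<^sup>2 * (1 / 2 ^ j) ^ ?d < v0"
  proof (rule order_tendstoD)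
    show "(\<lambda>j. (D * L ^ ?d)\<^sup>2 * (1 / 2 ^ j) ^ ?d) \<longlonglongrightarrow> 0"
      using tendsto_mult_right_zero[OF R0] .
  qed (rule v0)
  \<comment> \<open>Once \<kappa> 2^j exceeds 2, rounding down in \<open>M j\<close> loses at most
    half: M j \<ge> \<kappa>/2 * 2^j.\<close>
  moreover have "\<forall>\<^sub>F j in sequentially. 2 / \<kappa> < 2 ^ j"
  proof -
    have "filterlim (\<lambda>j. 2 ^ j :: real) at_top sequentially"
      using filterlim_two_powr_at_top[of 1 1] by (simp add: powr_realpow)
    then show ?thesis by (simp add: filterlim_at_top_dense)
  qed
  ultimately obtain J where J: "\<And>j. J \<le> j \<Longrightarrow> (D * L ^ ?d)\<^sup>2 * (1 / 2 ^ j) ^ ?d < v0 \<and> 2 / \<kappa> < 2 ^ j"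
    using eventually_conj unfolding eventually_sequentially by (metis (no_types, lifting) le_trans nle_le)
  have var': "(a j)\<^sup>2 * (v0 * (1 / 2 ^ j) ^ ?d) \<le> bb_cov ?P (w j n) (w j n)"
    if n: "n \<in> lattice_box (M j)" and j: "J \<le> j" for j n
  proof -
    define t :: real where "t = (1 / 2 ^ j) ^ ?d"
    have t: "0 < t" by (simp add: t_def)
    have x: "(y / 2 ^ j) ^ ?d = y ^ ?d * t" for y by (simp add: t_def power_divide)
    have "t * v0 \<le> t * (2 * v0 - (D * L ^ ?d)\<^sup>2 * t)"
      using J[OF j] t unfolding t_def[symmetric] by (intro mult_left_mono) auto
    also have "\<dots> = c * (I / 2 ^ j) ^ ?d - (D * (L / 2 ^ j) ^ ?d)\<^sup>2"
      unfolding x v0_def by (simp add: power2_eq_square algebra_simps)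
    finally have "(a j)\<^sup>2 * (t * v0) \<le> (a j)\<^sup>2 * (c * (I / 2 ^ j) ^ ?d - (D * (L / 2 ^ j) ^ ?d)\<^sup>2)"
      by (rule mult_left_mono) simp
    also note var[OF n]
    finally show ?thesis by (simp add: t_def mult.commute)
  qed
  define \<sigma> where "\<sigma> j n = sqrt (bb_cov ?P (w j n) (w j n))" for j n
  have cov_pos: "0 < bb_cov ?P (w j n) (w j n)" if "n \<in> lattice_box (M j)" "J \<le> j" for j n
    using var'[OF that] a[of j] v0 by (intro less_le_trans[OF _ var'[OF that]]) auto
  have \<sigma>_ge: "a j * sqrt v0 * 2 powr (- (real j * ?d / 2)) \<le> \<sigma> j n" if "n \<in> lattice_box (M j)" "J \<le> j" for j n
  proof (unfold \<sigma>_def, rule real_le_rsqrt)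
    have "(2 powr (- (real j * ?d / 2)))\<^sup>2 = (2 :: real) powr (- (real j * ?d))"
      by (simp add: power2_eq_square powr_add[symmetric])
    also have "\<dots> = (1 / 2 ^ j) ^ ?d"
      by (simp add: powr_minus powr_realpow power_mult power_inverse divide_inverse flip: of_nat_mult)
    finally have "(a j * sqrt v0 * 2 powr (- (real j * ?d / 2)))\<^sup>2 = (a j)\<^sup>2 * (v0 * (1 / 2 ^ j) ^ ?d)"
      using v0 by (simp add: power_mult_distrib)
    then show "(a j * sqrt v0 * 2 powr (- (real j * ?d / 2)))\<^sup>2 \<le> bb_cov ?P (w j n) (w j n)"
      using var'[OF that] by simp
  qed
  define e where "e = ?d / 2 - s"
  \<comment> \<open>About 2^(jd) atoms of standard deviation of order 2^(-(j+1)s - jd/2) contribute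
    2^(je) 2^(-s); the extra 2^(-s) is due to the block index being \<open>Suc j\<close>.\<close>
  define K0 where "K0 = (\<kappa> / 2) ^ ?d * sqrt v0 * (2 powr - s / B)"
  have e: "0 < e" using s by (simp add: e_def)
  have K0: "0 < K0" using \<kappa> v0 B by (simp add: K0_def)
  have sum_ge: "K0 * 2 powr (real j * e) \<le> (\<Sum>n\<in>lattice_box (M j). \<sigma> j n)" if j: "J \<le> j" for j
  proof -
    have "2 < \<kappa> * 2 ^ j" using J[OF j] \<kappa> by (simp add: divide_less_eq mult.commute)
    then have "\<kappa> / 2 * 2 ^ j \<le> real (M j)" using M(2)[of j] by simp
    then have "(\<kappa> / 2 * 2 ^ j) ^ ?d \<le> real (M j) ^ ?d" using \<kappa> by (intro power_mono) auto
    moreover have "(2 ^ j) ^ ?d = (2 :: real) powr (real j * ?d)"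
      by (simp add: powr_realpow power_mult flip: of_nat_mult)
    ultimately have M': "(\<kappa> / 2) ^ ?d * 2 powr (real j * ?d) \<le> real (M j) ^ ?d"
      by (simp only: power_mult_distrib)
    have "2 powr (real j * e) * 2 powr - s = 2 powr (real j * ?d) * (2 powr - (real (Suc j) * s) * 2 powr (- (real j * ?d / 2)))"
      unfolding powr_add[symmetric] e_def by (simp add: algebra_simps)
    then have "K0 * 2 powr (real j * e) = (\<kappa> / 2) ^ ?d * 2 powr (real j * ?d) * (a j * sqrt v0 * 2 powr (- (real j * ?d / 2)))"
      by (simp add: K0_def a_def field_simps)
    also have "\<dots> \<le> real (M j) ^ ?d * (a j * sqrt v0 * 2 powr (- (real j * ?d / 2)))"
      using a[of j] v0 by (intro mult_right_mono[OF M']) auto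
    also have "\<dots> = (\<Sum>n\<in>(lattice_box (M j) :: ('a \<Rightarrow> nat) set). a j * sqrt v0 * 2 powr (- (real j * ?d / 2)))"
      by (simp add: card_lattice_box)
    also have "\<dots> \<le> (\<Sum>n\<in>lattice_box (M j). \<sigma> j n)"
      by (intro sum_mono \<sigma>_ge j)
    finally show ?thesis .
  qed
  show False
  \<comment> \<open>Levels are counted from \<open>J\<close>, beyond which the variances are known
    to be positive and the lower bound on their sum is available.\<close>
  proof (rule \<Omega>.gaussian_sums_not_dominated[where I="\<lambda>j. lattice_box (M (j + J))" and \<sigma>="\<lambda>j. \<sigma> (j + J)"
        and X="\<lambda>j n. G (w (j + J) n)" and K=K])
    fix j and n :: "'a \<Rightarrow> nat" assume n: "n \<in> lattice_box (M (j + J))"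
    show "0 < \<sigma> (j + J) n" unfolding \<sigma>_def using cov_pos[OF n] by simp
    show "distributed \<Omega> lborel (G (w (j + J) n)) (normal_density 0 (\<sigma> (j + J) n))"
      unfolding \<sigma>_def by (rule brownian_bridge_normal[OF bb wU cov_pos[OF n]]) simp
  next
    have "filterlim (\<lambda>j. K0 * 2 powr (real (j + J) * e)) at_top sequentially"
      using filterlim_compose[OF filterlim_two_powr_at_top[OF e K0] filterlim_add_const_nat_at_top] by simp
    then show "filterlim (\<lambda>j. \<Sum>n\<in>lattice_box (M (j + J)). \<sigma> (j + J) n) at_top sequentially"
      by (rule filterlim_at_top_mono) (intro always_eventually allI sum_ge le_add2)
  next
    show "AE \<omega> in \<Omega>. \<forall>j. (\<Sum>n\<in>lattice_box (M (j + J)). \<bar>G (w (j + J) n) \<omega>\<bar>) \<le> K \<omega>"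
      using dom by eventually_elim blast
  qed simp
qed

theorem theorem6:
  fixes phi0 :: "real^'n \<Rightarrow> real"
    and s :: real and p q :: ennreal
    and dens :: "real^'n \<Rightarrow> real" and c :: real and V :: "(real^'n) set"
    and \<U> :: "(real^'n \<Rightarrow> real) set"
  assumes "C_infinity phi0"
    and "\<forall>x. norm x \<le> 1 \<longrightarrow> phi0 x = 1"
    and "\<forall>x. norm x \<ge> 3/2 \<longrightarrow> phi0 x = 0"
    and "1 \<le> p" and "1 \<le> q"
    and "0 < s" and "s < real CARD('n) / 2"
    and "\<forall>u\<in>\<U>. \<exists>g\<in>besov_unit_ball phi0 s p q. AE x in lebesgue. u x = g x"
    and "\<forall>g\<in>besov_unit_ball phi0 s p q. \<exists>!u. u \<in> \<U> \<and> (AE x in lebesgue. u x = g x)"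
    and "dens \<in> borel_measurable borel"
    and "\<forall>x. 0 \<le> dens x"
    and "bounded (range dens)"
    and "prob_space (density lebesgue (\<lambda>x. ennreal (dens x)))"
    and "0 < c" and "open V" and "V \<noteq> {}" and "\<forall>x\<in>V. c \<le> dens x"
  shows "\<not> pregaussian TYPE('w) (density lebesgue (\<lambda>x. ennreal (dens x))) \<U>"
proof (rule besov_unit_ball_not_pregaussian[OF assms(1-5) _ _ assms(10-17)])
  show "s < real DIM(real^'n) / 2" using assms(7) by simp
  show "\<forall>f\<in>besov_unit_ball phi0 s p q. \<exists>u\<in>\<U>. AE x in lebesgue. u x = f x"
    using assms(9) by blast
qed

end
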